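(* For every positive integer $n$ with $n\neq 6$ and $n\neq 10$, the $4$-girth-thickness of the complete graph $K_n$ satisfies $\theta(4,K_n)=\left\lceil \frac{n+2}{4}\right\rceil$. Moreover, $\theta(4,K_6)=3$.
   Context: All graphs are finite and simple. The girth of a graph is the length of a shortest cycle in it; an acyclic graph has girth $\infty$. For an integer $g\geq 3$ (or $g=\infty$), the $g$-girth-thickness $\theta(g,G)$ of a graph $G$ is the minimum number of planar subgraphs of $G$, each of girth at least $g$, whose union is $G$ (equivalently, the minimum number of parts in a partition of $E(G)$ such that each part spans a planar graph of girth at least $g$). $K_n$ denotes the complete graph on $n$ vertices. *)

theory Defs
  imports "HOL-Analysis.Analysis" "HOL-Library.Extended_Nat"
begin

record 'a sgraph =
  verts :: "'a set"
  edges :: "'a set set"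

definition simple_graph :: "'a sgraph \<Rightarrow> bool" where
  "simple_graph G \<longleftrightarrow>
     finite (verts G) \<and> (\<forall>e\<in>edges G. e \<subseteq> verts G \<and> card e = 2)"

definition subgraph :: "'a sgraph \<Rightarrow> 'a sgraph \<Rightarrow> bool" where
  "subgraph H G \<longleftrightarrow>
     simple_graph H \<and> verts H \<subseteq> verts G \<and> edges H \<subseteq> edges G"

definition complete_graph :: "nat \<Rightarrow> nat sgraph" where
  "complete_graph n = \<lparr>verts = {..<n}, edges = {e. e \<subseteq> {..<n} \<and> card e = 2}\<rparr>"

text \<open>A cycle is given by the list of its vertices in cyclic order, so the length of the
  list is the length of the cycle.\<close>

definition is_cycle :: "'a sgraph \<Rightarrow> 'a list \<Rightarrow> bool" where
  "is_cycle G c \<longleftrightarrow> length c \<ge> 3 \<and> distinct c \<and>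
     (\<forall>i<length c. {c ! i, c ! (Suc i mod length c)} \<in> edges G)"

text \<open>On \<^typ>\<open>enat\<close> the infimum of the empty set is \<open>\<infinity>\<close>, so acyclic graphs have
  girth \<open>\<infinity>\<close>.\<close>

definition girth :: "'a sgraph \<Rightarrow> enat" where
  "girth G = (INF c\<in>{c. is_cycle G c}. enat (length c))"

text \<open>The plane is the type \<^typ>\<open>complex\<close>. The last two conditions together say that the interior of
  an arc contains no vertex and no point of another arc.\<close>

definition plane_drawing ::
  "'a sgraph \<Rightarrow> ('a \<Rightarrow> complex) \<Rightarrow> ('a set \<Rightarrow> real \<Rightarrow> complex) \<Rightarrow> bool" where
  "plane_drawing G p \<gamma> \<longleftrightarrow>
     inj_on p (verts G) \<and>
     (\<forall>e\<in>edges G. arc (\<gamma> e) \<and> {pathstart (\<gamma> e), pathfinish (\<gamma> e)} = p ` e) \<and>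
     (\<forall>e\<in>edges G. path_image (\<gamma> e) \<inter> p ` verts G = p ` e) \<and>
     (\<forall>e\<in>edges G. \<forall>f\<in>edges G. e \<noteq> f \<longrightarrow>
        path_image (\<gamma> e) \<inter> path_image (\<gamma> f) = p ` (e \<inter> f))"

definition planar :: "'a sgraph \<Rightarrow> bool" where
  "planar G \<longleftrightarrow> (\<exists>p \<gamma>. plane_drawing G p \<gamma>)"

text \<open>The subgraphs must cover the vertices of \<open>G\<close> as well as its edges: this only matters
  for isolated vertices, and a graph with one vertex has girth-thickness 1, not 0.\<close>

definition girth_cover :: "enat \<Rightarrow> 'a sgraph \<Rightarrow> nat \<Rightarrow> (nat \<Rightarrow> 'a sgraph) \<Rightarrow> bool" where
  "girth_cover g G k H \<longleftrightarrow>
     (\<forall>i<k. subgraph (H i) G \<and> planar (H i) \<and> girth (H i) \<ge> g) \<and>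
     (\<Union>i<k. verts (H i)) = verts G \<and> (\<Union>i<k. edges (H i)) = edges G"

definition girth_thickness :: "enat \<Rightarrow> 'a sgraph \<Rightarrow> nat" where
  "girth_thickness g G = (LEAST k. \<exists>H. girth_cover g G k H)"

end

(* Lower bound. A plane triangle-free graph has V vertices, E edges and F faces. Adding its
   edges one by one, the Jordan curve theorem gives Euler's inequality V - E + F >= 2. If
   there are at least two faces, every face has at least 4 edges on its frontier, because a minimal
   separating set of edges has no pendant edge; and every edge is on the frontier of at most 2 faces
   by Janiszewski's theorem. Hence E <= 2 V - 4, and k such graphs cover K_n only if n + 2 <= 4 k.
   For n = 6 the extra layer is forced by the Ramsey number R(3,3) = 6.

   Upper bound. Split 4 k vertices into quadruples, each a 4-cycle with two pairs of opposite vertices.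
   Layer i consists of the 4-cycle of quadruple i, and of every other vertex joined to one pair of
   opposite vertices of quadruple i, chosen by a tournament on the quadruples so that the layers
   i and j together contain all edges between the quadruples i and j. What remains is a perfect
   matching, which goes into one more layer; two extra vertices are joined to half of the matched
   vertices each in that layer, and to the others inside faces of the first k layers. *)

theory Submission
  imports Defs
begin

section \<open>Arcs in the plane\<close>

text \<open>Faces are never built as objects. They are counted through points that the drawing
  separates pairwise, so inequalities suffice: a new arc splits a component or does not, and
  removing an arc merges at most two. The Jordan curve theorem separates points; Janiszewski's
  theorem keeps them together. In the upper bound n = 4 k + 2 is the extreme case: k + 1 layers of
  at most 2 n - 4 edges exceed the number of edges of K_n by only 2 k - 1. The obstacle is the pair
  of extra vertices. In layer i they sit next to a quadruple s other than i, the tournament must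
  lead from i to s, and every quadruple must serve as s once. A directed cycle through all
  quadruples provides this, but it needs k \<ge> 3. Hence n = 10, where k = 2, is outside the
  construction, and K_9 is drawn explicitly.\<close>

lemma connected_complement_arc:
  fixes g :: "real \<Rightarrow> complex"
  assumes "arc g" shows "connected (- path_image g)"
proof (rule connected_complement_homeomorphic_interval)
  show "path_image g homeomorphic cbox 0 (1::real)"
    using homeomorphic_arc_image_interval[OF assms, of 0 1] by simp
qed simp

text \<open>Otherwise the inverse of the arc would embed a nonempty open set of the plane in the
  real line, against invariance of dimension.\<close>

lemma arc_not_superset_open:
  fixes g :: "real \<Rightarrow> complex"
  assumes "arc g" "open D" "D \<noteq> {}"
  shows "\<exists>x\<in>D. x \<notin> path_image g"
proof (rule ccontr)
  assume "\<not> ?thesis"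
  then have sub: "D \<subseteq> path_image g" by blast
  obtain h where h: "homeomorphism {0..1} (path_image g) g h"
    using homeomorphism_arc[OF assms(1)] by blast
  have "continuous_on D h"
    using h sub continuous_on_subset homeomorphism_cont2 by blast
  moreover have "inj_on h D"
    using h sub by (intro inj_on_inverseI[of D g]) (auto simp: homeomorphism_def)
  ultimately have "DIM(complex) \<le> DIM(real)"
    using invariance_of_dimension assms by blast
  then show False by simp
qed

text \<open>Janiszewski's theorem, where one of the two closed sets is an arc and so separates
  nothing on its own.\<close>

lemma connected_component_Un_arc:
  fixes g :: "real \<Rightarrow> complex"
  assumes "arc g" "compact T" "connected (path_image g \<inter> T)"
    and "connected_component (- T) a b" "a \<notin> path_image g" "b \<notin> path_image g"
  shows "connected_component (- (T \<union> path_image g)) a b"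
proof -
  have "connected_component (- path_image g) a b"
    using connected_complement_arc[OF assms(1)] assms(5,6)
    by (simp add: connected_iff_connected_component)
  then have "connected_component (- (path_image g \<union> T)) a b"
    using Janiszewski[of "path_image g" T a b] assms compact_arc_image compact_imp_closed by blast
  then show ?thesis by (simp add: Un_commute)
qed

text \<open>The arc may meet \<open>T1 \<union> T2\<close> in a disconnected set, so Janiszewski's
  theorem is applied twice: first to \<open>T2\<close> and the arc, then to their union and
  \<open>T1\<close>, which meets it only on the arc.\<close>

lemma connected_component_Un_arc_bridge:
  fixes g :: "real \<Rightarrow> complex"
  assumes "arc g" "compact T1" "compact T2" "T1 \<inter> T2 = {}"
    and "connected (path_image g \<inter> T1)" "connected (path_image g \<inter> T2)"
    and ab: "connected_component (- (T1 \<union> T2)) a b" "a \<notin> path_image g" "b \<notin> path_image g"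
  shows "connected_component (- (T1 \<union> T2 \<union> path_image g)) a b"
proof -
  have 1: "connected_component (- T1) a b" "connected_component (- T2) a b"
    using ab(1) connected_component_of_subset[of "- (T1 \<union> T2)"] by blast+
  have "connected_component (- (T2 \<union> path_image g)) a b"
    using connected_component_Un_arc[OF assms(1,3,6) 1(2) ab(2,3)] .
  moreover have "T1 \<inter> (T2 \<union> path_image g) = path_image g \<inter> T1" using assms(4) by blast
  moreover have "closed (T2 \<union> path_image g)"
    using assms(1,3) by (simp add: closed_Un closed_arc_image compact_imp_closed)
  ultimately have "connected_component (- (T1 \<union> (T2 \<union> path_image g))) a b"
    using Janiszewski[of T1 "T2 \<union> path_image g" a b] assms(2,5) 1(1) by simp
  then show ?thesis by (simp add: Un_assoc)
qed

text \<open>An arc within a path component of \<open>T\<close> closes \<open>g\<close> to a Jordan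
  curve. The rest \<open>B\<close> of the curve is recorded as connected because Janiszewski's
  theorem will need that.\<close>

lemma arc_closing:
  fixes g :: "real \<Rightarrow> complex"
  assumes "arc g" "path_image g \<inter> T = {pathstart g, pathfinish g}"
    and "path_component T (pathstart g) (pathfinish g)"
  obtains c B where "simple_path c" "pathfinish c = pathstart c" "path_image c = path_image g \<union> B"
    "B \<subseteq> T" "connected B" "pathstart g \<in> B" "pathfinish g \<in> B"
proof -
  have ne: "pathfinish g \<noteq> pathstart g" using assms(1) arc_distinct_ends by metis
  define K where "K = path_component_set T (pathstart g)"
  have K: "path_connected K" "K \<subseteq> T" "pathstart g \<in> K" "pathfinish g \<in> K"
    using assms(2,3) path_component_subset by (auto simp: K_def path_component_refl_eq)
  then obtain d where d: "arc d" "path_image d \<subseteq> K" "pathstart d = pathfinish g" "pathfinish d = pathstart g"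
    using path_connected_arcwise[of K] ne by blast
  have "simple_path (g +++ d)"
    using assms(2) d K(2) by (intro simple_path_joinI assms(1) d(1)) auto
  moreover have "path_image (g +++ d) = path_image g \<union> path_image d"
    using d by (simp add: path_image_join)
  moreover have "pathstart g \<in> path_image d" "pathfinish g \<in> path_image d"
    using d pathstart_in_path_image[of d] pathfinish_in_path_image[of d] by simp_all
  ultimately show thesis
    using that[of "g +++ d" "path_image d"] d K connected_arc_image by auto
qed

text \<open>Every point of a Jordan curve is on the frontier of both sides, so a ball that avoids
  \<open>T\<close> around an inner point of the arc contains points of both.\<close>

lemma arc_separates_nearby:
  fixes g :: "real \<Rightarrow> complex"
  assumes "arc g" "closed T" "path_image g \<inter> T = {pathstart g, pathfinish g}"
    and "path_component T (pathstart g) (pathfinish g)"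
  obtains a b where "a \<notin> path_image g" "b \<notin> path_image g"
    "connected_component (- T) a b" "\<not> connected_component (- (T \<union> path_image g)) a b"
proof -
  obtain c B where c: "simple_path c" "pathfinish c = pathstart c" "path_image c = path_image g \<union> B"
    "B \<subseteq> T" "connected B" using arc_closing[OF assms(1,3,4)] by metis
  let ?C = "path_image c"
  note J = Jordan_inside_outside[OF c(1,2)]
  obtain x where x: "x \<in> path_image g" "x \<notin> T"
    using nonempty_simple_path_endless[OF arc_imp_simple_path[OF assms(1)]] assms(3) by blast
  then obtain r where r: "r > 0" "ball x r \<subseteq> - T"
    using assms(2) openE[of "- T" x] by (auto simp: open_Compl)
  have "x \<in> frontier (inside ?C)" "x \<in> frontier (outside ?C)" using J x c by auto
  then have "x \<in> closure (inside ?C)" "x \<in> closure (outside ?C)" by (auto simp: frontier_def)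
  then obtain a b where a: "a \<in> inside ?C" "a \<in> ball x r" and b: "b \<in> outside ?C" "b \<in> ball x r"
    using r(1) unfolding closure_approachable mem_ball by (metis dist_commute)
  show thesis
  proof
    show "a \<notin> path_image g" "b \<notin> path_image g" using a b J c(3) by blast+
    show "connected_component (- T) a b"
      using r(2) a b by (meson connected_component_def connected_ball)
    show "\<not> connected_component (- (T \<union> path_image g)) a b"
    proof
      assume "connected_component (- (T \<union> path_image g)) a b"
      then have "connected_component (- ?C) a b"
        using c(3,4) by (auto elim!: connected_component_of_subset)
      then have "b \<in> inside ?C" using a(1) inside_same_component by blast
      then show False using b J by blast
    qed
  qed
qed

text \<open>Two of the three points are on the same side of the Jordan curve through
  \<open>g\<close>. The curve meets \<open>T\<close> exactly in the connected set \<open>B\<close>,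
  so Janiszewski's theorem joins these two.\<close>

lemma arc_at_most_two_sides:
  fixes g :: "real \<Rightarrow> complex"
  assumes "arc g" "compact T" "path_image g \<inter> T = {pathstart g, pathfinish g}"
    and "path_component T (pathstart g) (pathfinish g)"
    and "a1 \<notin> path_image g" "a2 \<notin> path_image g" "a3 \<notin> path_image g"
    and T: "connected_component (- T) a1 a2" "connected_component (- T) a1 a3"
      "connected_component (- T) a2 a3"
  shows "connected_component (- (T \<union> path_image g)) a1 a2 \<or>
    connected_component (- (T \<union> path_image g)) a1 a3 \<or>
    connected_component (- (T \<union> path_image g)) a2 a3"
proof -
  obtain c B where c: "simple_path c" "pathfinish c = pathstart c" "path_image c = path_image g \<union> B"
    "B \<subseteq> T" "connected B" "pathstart g \<in> B" "pathfinish g \<in> B"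
    using arc_closing[OF assms(1,3,4)] by metis
  let ?C = "path_image c"
  note J = Jordan_inside_outside[OF c(1,2)]
  have U: "?C \<union> T = T \<union> path_image g" using c(3,4) by blast
  have "path_image g \<inter> T \<subseteq> B" using c(6,7) assms(3) by simp
  then have I: "?C \<inter> T = B" using c(3,4) by blast
  have same: "connected_component (- (T \<union> path_image g)) a b"
    if "connected_component (- T) a b" "connected_component (- ?C) a b" for a b
    using Janiszewski[of ?C T a b] that assms(2) c(1,5) U I
    by (simp add: compact_simple_path_image compact_imp_closed)
  have side: "connected_component (- ?C) a b"
    if "a \<in> S" "b \<in> S" "S = inside ?C \<or> S = outside ?C" for a b S
  proof -
    have "connected S" "S \<subseteq> - ?C" using that(3) J by blast+
    then show ?thesis using that(1,2) connected_component_def by metis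
  qed
  have nT: "a \<notin> T" if "a \<in> {a1,a2,a3}" for a
    using connected_component_in[OF T(1)] connected_component_in[OF T(2)] that by auto
  have "a \<in> inside ?C \<union> outside ?C" if "a \<in> {a1,a2,a3}" for a
  proof -
    have "a \<notin> path_image g" using that assms(5-7) by auto
    then have "a \<in> - ?C" using nT[OF that] c(3,4) by blast
    then show ?thesis using J by metis
  qed
  then have "a1 \<in> inside ?C \<or> a1 \<in> outside ?C" "a2 \<in> inside ?C \<or> a2 \<in> outside ?C"
    "a3 \<in> inside ?C \<or> a3 \<in> outside ?C" by blast+
  then have "connected_component (- ?C) a1 a2 \<or> connected_component (- ?C) a1 a3 \<or>
      connected_component (- ?C) a2 a3"
    using side[of _ "inside ?C"] side[of _ "outside ?C"] by (elim disjE) simp_all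
  then show ?thesis using same[OF T(1)] same[OF T(2)] same[OF T(3)] by argo
qed

text \<open>Each point moves within its own open component to a place that the arc misses; enlarging
  the closed set cannot join separated points.\<close>

lemma separated_points_avoid_arc:
  fixes g :: "real \<Rightarrow> complex"
  assumes "arc g" "closed T" "A \<subseteq> - T"
    and "pairwise (\<lambda>a b. \<not> connected_component (- T) a b) A"
  obtains m where "\<And>a. a \<in> A \<Longrightarrow> connected_component (- T) a (m a)"
    "\<And>a. a \<in> A \<Longrightarrow> m a \<notin> T \<union> path_image g" "inj_on m A"
    "pairwise (\<lambda>a b. \<not> connected_component (- (T \<union> path_image g)) a b) (m ` A)"
proof -
  have "\<exists>x. connected_component (- T) a x \<and> x \<notin> T \<union> path_image g" if "a \<in> A" for a
  proof -
    have "open (connected_component_set (- T) a)"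
      using assms(2) by (simp add: open_Compl open_connected_component)
    moreover have "a \<in> connected_component_set (- T) a" using that assms(3) by auto
    ultimately obtain x where "x \<in> connected_component_set (- T) a" "x \<notin> path_image g"
      using arc_not_superset_open[OF assms(1)] by (metis empty_iff)
    then show ?thesis using connected_component_in by fastforce
  qed
  then obtain m where m: "\<And>a. a \<in> A \<Longrightarrow> connected_component (- T) a (m a)"
    "\<And>a. a \<in> A \<Longrightarrow> m a \<notin> T \<union> path_image g" by metis
  have sep: "a = b" if "a \<in> A" "b \<in> A" "connected_component (- T) (m a) (m b)" for a b
    using m(1)[OF that(1)] m(1)[OF that(2)] that assms(4)
    by (metis connected_component_sym connected_component_trans pairwiseD)
  have "inj_on m A"
  proof (rule inj_onI)
    fix a b assume ab: "a \<in> A" "b \<in> A" "m a = m b"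
    then have "connected_component (- T) (m a) (m b)" using m(2)[of b] by auto
    then show "a = b" using sep ab by blast
  qed
  moreover have "pairwise (\<lambda>a b. \<not> connected_component (- (T \<union> path_image g)) a b) (m ` A)"
    unfolding pairwise_def using sep connected_component_of_subset[of _ _ _ "- T"]
    by (metis (no_types, lifting) Compl_anti_mono Un_upper1 imageE)
  ultimately show thesis using m that by blast
qed

section \<open>Plane triangle-free graphs have few edges\<close>

locale drawn_graph =
  fixes V :: "'a set" and E :: "'a set set"
    and p :: "'a \<Rightarrow> complex" and \<gamma> :: "'a set \<Rightarrow> real \<Rightarrow> complex"
  assumes finite_V: "finite V"
    and edge_subset: "e \<in> E \<Longrightarrow> e \<subseteq> V"
    and card_edge: "e \<in> E \<Longrightarrow> card e = 2"
    and arc_edge: "e \<in> E \<Longrightarrow> arc (\<gamma> e)"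
    and ends_edge: "e \<in> E \<Longrightarrow> {pathstart (\<gamma> e), pathfinish (\<gamma> e)} = p ` e"
    and edges_meet: "e \<in> E \<Longrightarrow> f \<in> E \<Longrightarrow> e \<noteq> f \<Longrightarrow>
      path_image (\<gamma> e) \<inter> path_image (\<gamma> f) = p ` (e \<inter> f)"
begin

definition img :: "'a set set \<Rightarrow> complex set" where
  "img X = (\<Union>e\<in>X. path_image (\<gamma> e))"

lemma finite_E: "finite E"
  using edge_subset finite_V by (auto intro!: finite_subset[of E "Pow V"])

lemma img_insert: "img (insert e X) = img X \<union> path_image (\<gamma> e)"
  by (auto simp: img_def)

lemma img_mono: "X \<subseteq> Y \<Longrightarrow> img X \<subseteq> img Y"
  by (auto simp: img_def)

lemma compact_img: "X \<subseteq> E \<Longrightarrow> compact (img X)"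
  unfolding img_def using finite_E arc_edge
  by (intro compact_UN) (auto intro: finite_subset compact_arc_image)

lemma closed_img: "X \<subseteq> E \<Longrightarrow> closed (img X)"
  by (simp add: compact_img compact_imp_closed)

lemma ends_subset: "e \<in> E \<Longrightarrow> p ` e \<subseteq> path_image (\<gamma> e)"
  by (metis ends_edge empty_subsetI insert_subset pathfinish_in_path_image pathstart_in_path_image)

lemma edge_Int_img:
  assumes "e \<in> E" "X \<subseteq> E" "e \<notin> X"
  shows "path_image (\<gamma> e) \<inter> img X = p ` (e \<inter> \<Union>X)"
proof -
  have "path_image (\<gamma> e) \<inter> img X = (\<Union>f\<in>X. path_image (\<gamma> e) \<inter> path_image (\<gamma> f))"
    by (auto simp: img_def)
  also have "\<dots> = (\<Union>f\<in>X. p ` (e \<inter> f))"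
    using assms by (intro SUP_cong refl edges_meet) auto
  finally show ?thesis by auto
qed

lemma edge_ends:
  assumes "e \<in> E"
  obtains u v where "e = {u, v}" "u \<noteq> v" "u \<in> V" "v \<in> V" "pathstart (\<gamma> e) = p u"
    "pathfinish (\<gamma> e) = p v"
proof -
  obtain x y where xy: "e = {x, y}" "x \<noteq> y" using card_edge[OF assms] by (auto simp: card_2_iff)
  then have V: "x \<in> V" "y \<in> V" using edge_subset[OF assms] by auto
  have "{pathstart (\<gamma> e), pathfinish (\<gamma> e)} = {p x, p y}" using ends_edge[OF assms] xy by simp
  then consider "pathstart (\<gamma> e) = p x" "pathfinish (\<gamma> e) = p y"
    | "pathstart (\<gamma> e) = p y" "pathfinish (\<gamma> e) = p x" by (auto simp: doubleton_eq_iff)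
  then show thesis using that[of x y] that[of y x] xy V by cases (auto simp: insert_commute)
qed

lemma path_component_edge:
  assumes "e \<in> E" "e \<in> X" "u \<in> e" "v \<in> e"
  shows "path_component (img X) (p u) (p v)"
proof -
  have "path_connected (path_image (\<gamma> e))"
    using arc_edge[OF assms(1)] by (simp add: arc_imp_path path_connected_path_image)
  then have "path_component (path_image (\<gamma> e)) (p u) (p v)"
    using ends_subset[OF assms(1)] assms(3,4) by (auto simp: path_connected_component)
  then show ?thesis
    by (rule path_component_of_subset[rotated]) (use assms(2) in \<open>auto simp: img_def\<close>)
qed

text \<open>A vertex without edges may lie off \<open>img X\<close>, where
  \<open>path_component\<close> is not reflexive; hence the first disjunct.\<close>

definition linked :: "'a set set \<Rightarrow> 'a \<Rightarrow> 'a \<Rightarrow> bool" where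
  "linked X u v \<longleftrightarrow> u = v \<or> path_component (img X) (p u) (p v)"

lemma linked_trans: "linked X u v \<Longrightarrow> linked X v w \<Longrightarrow> linked X u w"
  by (metis linked_def path_component_trans)

lemma linked_mono: "linked X u v \<Longrightarrow> X \<subseteq> Y \<Longrightarrow> linked Y u v"
  by (metis img_mono linked_def path_component_of_subset)

text \<open>Such an \<open>A\<close> consists of representatives of different faces, and
  \<open>card A\<close> is a lower bound for the number of faces.\<close>

abbreviation separated :: "'a set set \<Rightarrow> complex set \<Rightarrow> bool" where
  "separated X A \<equiv> finite A \<and> A \<subseteq> - img X \<and> pairwise (\<lambda>a b. \<not> connected_component (- img X) a b) A"

text \<open>The labelling \<open>c\<close> plays the role of the components of the graph: vertices with equal
  labels are linked, but not necessarily conversely.\<close>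

lemma euler_inequality:
  assumes "X \<subseteq> E"
  shows "\<exists>(c :: 'a \<Rightarrow> 'a) A. (\<forall>x\<in>V. \<forall>y\<in>V. c x = c y \<longrightarrow> linked X x y) \<and> separated X A \<and>
    card X + 1 + card (c ` V) \<le> card A + card V"
proof -
  have "finite X" using assms finite_E finite_subset by blast
  then show ?thesis using assms
  proof (induction X rule: finite_induct)
    case empty
    \<comment> \<open>Without edges every vertex has its own label, and the whole plane is one face,
      represented by 0.\<close>
    show ?case by (rule exI[of _ id], rule exI[of _ "{0}"]) (auto simp: linked_def img_def)
  next
    case (insert e X)
    then have X: "X \<subseteq> E" "e \<in> E" "e \<notin> X" by auto
    obtain c :: "'a \<Rightarrow> 'a" and A where c: "\<And>x y. x \<in> V \<Longrightarrow> y \<in> V \<Longrightarrow> c x = c y \<Longrightarrow> linked X x y"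
      and A: "separated X A" and card: "card X + 1 + card (c ` V) \<le> card A + card V"
      using insert.IH X(1) by blast
    obtain u v where uv: "e = {u, v}" "u \<noteq> v" "u \<in> V" "v \<in> V" "pathstart (\<gamma> e) = p u"
      "pathfinish (\<gamma> e) = p v" using edge_ends[OF X(2)] by metis
    note arc = arc_edge[OF X(2)]
    note cl = closed_img[OF X(1)]
    have cX: "card (insert e X) = card X + 1" using insert.hyps by simp
    let ?g = "path_image (\<gamma> e)"
    obtain m where m: "\<And>a. a \<in> A \<Longrightarrow> connected_component (- img X) a (m a)"
      "\<And>a. a \<in> A \<Longrightarrow> m a \<notin> img X \<union> ?g" "inj_on m A"
      "pairwise (\<lambda>a b. \<not> connected_component (- (img X \<union> ?g)) a b) (m ` A)"
      using separated_points_avoid_arc[OF arc cl, of A] A by blast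
    show ?case
    proof (cases "c u = c v")
      \<comment> \<open>The ends are already linked, so \<open>e\<close> closes a curve and splits a
        face.\<close>
      case True
      then have pc: "path_component (img X) (p u) (p v)"
        using c[of u v] uv by (auto simp: linked_def)
      then have "p u \<in> img X" "p v \<in> img X" using path_component_mem by blast+
      then have "?g \<inter> img X = {pathstart (\<gamma> e), pathfinish (\<gamma> e)}"
        using edge_Int_img[OF X(2,1,3)] uv ends_subset[OF X(2)] by auto
      then obtain a b where ab: "a \<notin> ?g" "b \<notin> ?g" "connected_component (- img X) a b"
        "\<not> connected_component (- (img X \<union> ?g)) a b"
        using arc_separates_nearby[OF arc cl] pc uv(5,6) by metis
      \<comment> \<open>At most one old representative lies in the face that \<open>e\<close>
        splits. It is dropped in favour of \<open>a\<close> and \<open>b\<close>, which gains at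
        least one.\<close>
      define A0 where "A0 = {x\<in>A. \<not> connected_component (- img X) a x}"
      let ?B = "insert a (insert b (m ` A0))"
      have "a \<noteq> b" using ab(3,4) ab(1) connected_component_in[OF ab(3)]
        by (metis ComplI UnE ComplD connected_component_refl)
      have far: "\<not> connected_component (- img X) a (m x)" if "x \<in> A0" for x
        using that m(1)[of x] by (metis (mono_tags, lifting) A0_def connected_component_sym
            connected_component_trans mem_Collect_eq)
      then have far': "\<not> connected_component (- img X) b (m x)" if "x \<in> A0" for x
        using that ab(3) connected_component_trans by metis
      have small: "connected_component (- img X) x y"
        if "connected_component (- (img X \<union> ?g)) x y" for x y
        using that by (rule connected_component_of_subset) auto
      have ref: "connected_component (- img X) a a" "connected_component (- img X) b b"
        using connected_component_in[OF ab(3)] by auto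
      have nin: "a \<notin> m ` A0" "b \<notin> m ` A0" using far far' ref by (metis imageE)+
      have "A - A0 \<subseteq> {x\<in>A. connected_component (- img X) a x}" by (auto simp: A0_def)
      moreover have "x = y" if "x \<in> A" "y \<in> A" "connected_component (- img X) a x"
        "connected_component (- img X) a y" for x y
        using that A by (metis connected_component_sym connected_component_trans pairwiseD)
      ultimately have "is_singleton (A - A0) \<or> A - A0 = {}"
        by (smt (verit, best) is_singletonI' mem_Collect_eq subsetD)
      then have "card (A - A0) \<le> 1" unfolding is_singleton_altdef by (metis card.empty order_refl zero_le_one)
      moreover have fin: "finite A0" "A0 \<subseteq> A" using A by (auto simp: A0_def)
      ultimately have cA: "card A \<le> card A0 + 1" using card_Diff_subset[of A0 A] by linarith
      have "card (m ` A0) = card A0" using m(3) fin by (meson card_image inj_on_subset)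
      then have "card ?B = card A0 + 2" using nin fin \<open>a \<noteq> b\<close> by simp
      then have "card (insert e X) + 1 + card (c ` V) \<le> card ?B + card V"
        using cX cA card by linarith
      moreover have "?B \<subseteq> - img (insert e X)"
        using ab(1,2) connected_component_in[OF ab(3)] m(2) fin by (auto simp: img_insert)
      moreover have "pairwise (\<lambda>a b. \<not> connected_component (- img (insert e X)) a b) ?B"
      proof -
        have "pairwise (\<lambda>a b. \<not> connected_component (- (img X \<union> ?g)) a b) (m ` A0)"
          using m(4) fin(2) by (meson image_mono pairwise_subset)
        moreover have "\<not> connected_component (- (img X \<union> ?g)) a y"
          "\<not> connected_component (- (img X \<union> ?g)) b y"
          "\<not> connected_component (- (img X \<union> ?g)) y a"
          "\<not> connected_component (- (img X \<union> ?g)) y b" if "y \<in> m ` A0" for y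
          using that far far' small connected_component_sym by blast+
        moreover have "\<not> connected_component (- (img X \<union> ?g)) b a"
          using ab(4) connected_component_sym by blast
        ultimately show ?thesis
          using ab(4) unfolding img_insert pairwise_insert by blast
      qed
      ultimately show ?thesis
        using fin c linked_mono[OF _ subset_insertI[of X e]]
        by (intro exI[of _ c] exI[of _ ?B]) auto
    next
      case False
      \<comment> \<open>Merging two labels lowers their number by one, which pays for the new edge;
        the number of representatives stays the same.\<close>
      define c' where "c' = (\<lambda>x. if c x = c u then c v else c x)"
      have "c' ` V \<subseteq> c ` V - {c u}" using False uv by (auto simp: c'_def)
      then have "card (c' ` V) \<le> card (c ` V - {c u})" using finite_V by (intro card_mono) auto
      moreover have "c u \<in> c ` V" using uv by auto
      ultimately have "card (c' ` V) + 1 \<le> card (c ` V)"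
        using finite_V card_Suc_Diff1[of "c ` V" "c u"] by auto
      moreover have "card (m ` A) = card A" using m(3) by (rule card_image)
      ultimately have "card (insert e X) + 1 + card (c' ` V) \<le> card (m ` A) + card V"
        using cX card by linarith
      moreover have "linked (insert e X) x y" if "x \<in> V" "y \<in> V" "c' x = c' y" for x y
      proof -
        have mono: "linked X a b \<Longrightarrow> linked (insert e X) a b" for a b
          by (meson linked_mono subset_insertI)
        have 1: "linked (insert e X) u v" "linked (insert e X) v u"
          using path_component_edge[OF X(2), of "insert e X"] uv by (auto simp: linked_def)
        have "c x = c y \<or> (c x = c u \<and> c y = c v) \<or> (c x = c v \<and> c y = c u)"
          using that(3) by (auto simp: c'_def split: if_splits)
        then show ?thesis using c mono 1 linked_trans that(1,2) uv(3,4) by metis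
      qed
      moreover have "m ` A \<subseteq> - img (insert e X)" using m(2) by (auto simp: img_insert)
      ultimately show ?thesis
        using A m(4) by (intro exI[of _ c'] exI[of _ "m ` A"]) (auto simp: img_insert)
    qed
  qed
qed

text \<open>A pendant edge meets the remaining edges in at most one point, so by Janiszewski's
  theorem putting it back separates nothing.\<close>

lemma separated_remove_pendant:
  assumes "X \<subseteq> E" "e \<in> X" "u \<in> e" "\<And>f. f \<in> X \<Longrightarrow> u \<in> f \<Longrightarrow> f = e"
    and "a \<notin> img X" "b \<notin> img X" "\<not> connected_component (- img X) a b"
  shows "\<not> connected_component (- img (X - {e})) a b"
proof
  assume *: "connected_component (- img (X - {e})) a b"
  have e: "e \<in> E" using assms by blast
  obtain v where v: "e = {u, v}" using card_edge[OF e] assms(3) by (auto simp: card_2_iff)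
  have "e \<inter> \<Union>(X - {e}) \<subseteq> {v}" using assms(4) v by auto
  then have "path_image (\<gamma> e) \<inter> img (X - {e}) \<subseteq> {p v}"
    using edge_Int_img[OF e, of "X - {e}"] assms(1) by auto
  then have "path_image (\<gamma> e) \<inter> img (X - {e}) = {} \<or> path_image (\<gamma> e) \<inter> img (X - {e}) = {p v}"
    by blast
  then have "connected (path_image (\<gamma> e) \<inter> img (X - {e}))" by auto
  moreover have "img X = img (X - {e}) \<union> path_image (\<gamma> e)" using assms(2) img_insert[of e "X - {e}"]
    by (simp add: insert_absorb)
  ultimately show False
    using connected_component_Un_arc[OF arc_edge[OF e], of "img (X - {e})" a b] * assms compact_img[of "X - {e}"]
    by (metis Diff_subset Un_iff order_trans)
qed

end

text \<open>An edge \<open>{u, v}\<close> is extended at both ends, to \<open>w\<close> and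
  \<open>z\<close>, which differ because there is no triangle, and then once more at
  \<open>w\<close>.\<close>

lemma four_le_card_no_pendant_edge:
  fixes X :: "'a set set"
  assumes "finite X" "X \<noteq> {}" and two: "\<And>e. e \<in> X \<Longrightarrow> card e = 2"
    and other: "\<And>e u. e \<in> X \<Longrightarrow> u \<in> e \<Longrightarrow> \<exists>f\<in>X. f \<noteq> e \<and> u \<in> f"
    and tri: "\<And>u v w. {u, v} \<in> X \<Longrightarrow> {v, w} \<in> X \<Longrightarrow> {u, w} \<in> X \<Longrightarrow> False"
  shows "4 \<le> card X"
proof -
  have nb: "\<exists>w. w \<noteq> v \<and> w \<noteq> u \<and> {u, w} \<in> X" if "{u, v} \<in> X" for u v
  proof -
    have "\<exists>f\<in>X. f \<noteq> {u, v} \<and> u \<in> f" using other[OF that] by simp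
    then obtain f where f: "f \<in> X" "f \<noteq> {u, v}" "u \<in> f" by blast
    then obtain w where "f = {u, w}" "w \<noteq> u" using two[OF f(1)] by (auto simp: card_2_iff)
    then show ?thesis using f by metis
  qed
  obtain e where "e \<in> X" using assms(2) by blast
  then obtain u v where uv: "{u, v} \<in> X" "u \<noteq> v" using two[of e] by (auto simp: card_2_iff)
  obtain w where w: "w \<noteq> v" "w \<noteq> u" "{u, w} \<in> X" using nb[OF uv(1)] by blast
  obtain z where z: "z \<noteq> u" "z \<noteq> v" "{v, z} \<in> X" using nb[of v u] uv by (auto simp: insert_commute)
  have wz: "w \<noteq> z" using tri[of u v w] uv w z by auto
  obtain y where y: "y \<noteq> u" "y \<noteq> w" "{w, y} \<in> X" using nb[of w u] w by (auto simp: insert_commute)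
  have "card {{u, v}, {u, w}, {v, z}, {w, y}} = 4"
    using uv w z wz y by (auto simp: doubleton_eq_iff card_insert_if)
  moreover have "card {{u, v}, {u, w}, {v, z}, {w, y}} \<le> card X"
    using uv w z y assms(1) by (intro card_mono) auto
  ultimately show ?thesis by simp
qed

locale drawn_triangle_free = drawn_graph +
  assumes triangle_free: "\<And>u v w. {u, v} \<in> E \<Longrightarrow> {v, w} \<in> E \<Longrightarrow> {u, w} \<in> E \<Longrightarrow> False"
begin

text \<open>Dropping a pendant edge does not join \<open>a\<close> and \<open>b\<close>, so the
  induction ends at a nonempty set of edges without pendant ones.\<close>

lemma separating_four_edges:
  assumes "X \<subseteq> E" "a \<notin> img X" "b \<notin> img X" "\<not> connected_component (- img X) a b"
  shows "4 \<le> card X"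
proof -
  have "finite X" using assms(1) finite_E finite_subset by blast
  then show ?thesis using assms
  proof (induction X rule: finite_psubset_induct)
    case (psubset X)
    show ?case
    proof (cases "\<exists>e\<in>X. \<exists>u\<in>e. \<forall>f\<in>X. u \<in> f \<longrightarrow> f = e")
      case True
      then obtain e u where e: "e \<in> X" "u \<in> e" "\<And>f. f \<in> X \<Longrightarrow> u \<in> f \<Longrightarrow> f = e" by blast
      have "\<not> connected_component (- img (X - {e})) a b"
        using separated_remove_pendant[OF psubset.prems(1) e psubset.prems(2-4)] .
      moreover have "a \<notin> img (X - {e})" "b \<notin> img (X - {e})"
        using psubset.prems(2,3) img_mono[of "X - {e}" X] by blast+
      ultimately have "4 \<le> card (X - {e})"
        using psubset.IH[of "X - {e}"] psubset.prems(1) e(1) by blast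
      then show ?thesis using card_Diff1_le[of X e] by linarith
    next
      case False
      have "connected_component UNIV a b" by (auto simp: connected_component_def intro: exI[of _ UNIV])
      then have "X \<noteq> {}" using psubset.prems(4) by (auto simp: img_def)
      then show ?thesis
      proof (rule four_le_card_no_pendant_edge[OF psubset.hyps])
        show "card e = 2" if "e \<in> X" for e using that psubset.prems(1) card_edge by blast
        show "\<exists>f\<in>X. f \<noteq> e \<and> u \<in> f" if "e \<in> X" "u \<in> e" for e u using that False by blast
        show False if "{u, v} \<in> X" "{v, w} \<in> X" "{u, w} \<in> X" for u v w
          using that psubset.prems(1) triangle_free by blast
      qed
    qed
  qed
qed

text \<open>The ends are left out, so that an edge touching the frontier of the face only in a
  vertex does not count.\<close>

definition border :: "complex \<Rightarrow> 'a set set" where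
  "border a = {e\<in>E. (path_image (\<gamma> e) - p ` e) \<inter> frontier (connected_component_set (- img E) a) \<noteq> {}}"

text \<open>An open connected set in the plane stays connected without finitely many vertex points.
  A connection off the border edges would therefore cross the frontier of the face inside some edge,
  which is then a border edge itself.\<close>

lemma border_separates:
  assumes "a \<notin> img E" "b \<notin> img E" "\<not> connected_component (- img E) a b"
  shows "\<not> connected_component (- img (border a)) a b"
proof
  assume *: "connected_component (- img (border a)) a b"
  define F where "F = connected_component_set (- img E) a"
  define W where "W = connected_component_set (- img (border a)) a - p ` \<Union>E"
  have sub: "border a \<subseteq> E" by (auto simp: border_def)
  have "finite (p ` \<Union>E)" using finite_V edge_subset by (auto intro!: finite_subset[of "\<Union>E" V])
  moreover have "open (connected_component_set (- img (border a)) a)"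
    using closed_img[OF sub] by (simp add: open_Compl open_connected_component)
  ultimately have "connected W"
    unfolding W_def by (intro connected_open_delete_finite) auto
  have "p ` \<Union>E \<subseteq> img E" using ends_subset by (auto simp: img_def)
  then have "a \<in> W" "b \<in> W"
    using assms(1,2) * connected_component_in[OF *] by (auto simp: W_def)
  moreover have "a \<in> F" "b \<notin> F" using assms by (auto simp: F_def)
  ultimately obtain z where z: "z \<in> W" "z \<in> frontier F"
    using connected_Int_frontier[OF \<open>connected W\<close>, of F] by blast
  have "frontier F \<subseteq> frontier (- img E)"
    unfolding F_def by (rule frontier_of_connected_component_subset)
  then have "z \<in> img E" using z(2) closed_img[of E] frontier_subset_closed by (auto simp: frontier_complement)
  then obtain e where e: "e \<in> E" "z \<in> path_image (\<gamma> e)" by (auto simp: img_def)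
  moreover have "z \<notin> p ` e" using z(1) e(1) by (auto simp: W_def)
  ultimately have "e \<in> border a" using z(2) by (auto simp: border_def F_def)
  then have "z \<in> img (border a)" using e by (auto simp: img_def)
  then show False using z(1) connected_component_in by (fastforce simp: W_def)
qed

lemma border_at_least_4:
  assumes "a \<notin> img E" "b \<notin> img E" "\<not> connected_component (- img E) a b"
  shows "4 \<le> card (border a)"
proof (rule separating_four_edges)
  show sub: "border a \<subseteq> E" by (auto simp: border_def)
  show "a \<notin> img (border a)" "b \<notin> img (border a)" using assms(1,2) img_mono[OF sub] by blast+
  show "\<not> connected_component (- img (border a)) a b" using border_separates[OF assms] .
qed

text \<open>The interior of \<open>e\<close> is connected and misses the other edges, so it lies in
  one open component of their complement, and the face of \<open>a\<close> reaches into that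
  component.\<close>

lemma border_near_edge:
  assumes "e \<in> border a" "a \<notin> img E" "x \<in> path_image (\<gamma> e) - p ` e"
  shows "connected_component (- img (E - {e})) a x"
proof -
  have e: "e \<in> E" using assms(1) by (simp add: border_def)
  define D where "D = connected_component_set (- img (E - {e})) x"
  let ?i = "path_image (\<gamma> e) - p ` e"
  have cl: "closed (img (E - {e}))" by (rule closed_img) auto
  have disj: "?i \<inter> img (E - {e}) = {}"
    using edge_Int_img[OF e, of "E - {e}"] by auto
  have "connected ?i"
    using connected_simple_path_endless[OF arc_imp_simple_path[OF arc_edge[OF e]]] ends_edge[OF e]
    by simp
  then have iD: "?i \<subseteq> D" unfolding D_def using assms(3) disj
    by (intro connected_component_maximal) auto
  have "open D" using cl by (simp add: D_def open_Compl open_connected_component)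
  obtain y where y: "y \<in> ?i" "y \<in> frontier (connected_component_set (- img E) a)"
    using assms(1) by (auto simp: border_def)
  then have "y \<in> closure (connected_component_set (- img E) a)" by (simp add: frontier_def)
  then obtain z where z: "z \<in> D" "z \<in> connected_component_set (- img E) a"
    using \<open>open D\<close> iD y(1) by (meson closure_iff_nhds_not_empty subsetD disjoint_iff order_refl)
  have "connected_component (- img (E - {e})) a z"
    using z(2) img_mono[of "E - {e}" E] by (auto elim!: connected_component_of_subset)
  moreover have "connected_component (- img (E - {e})) z x"
    using z(1) by (simp add: D_def connected_component_sym)
  ultimately show ?thesis using connected_component_trans by metis
qed

text \<open>If the ends of \<open>e\<close> are linked without \<open>e\<close>, then \<open>e\<close> lies on a Jordan curve, and by Janiszewski's
  theorem two points on the same side of this curve are separated by \<open>E\<close> only if they are separated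
  by \<open>E - {e}\<close>. Otherwise \<open>e\<close> is a bridge, and does not separate anything.\<close>

lemma edge_borders_at_most_2:
  assumes A: "separated E A" and e: "e \<in> E"
  shows "card {a\<in>A. e \<in> border a} \<le> 2"
proof (rule ccontr)
  assume "\<not> ?thesis"
  then have "3 \<le> card {a\<in>A. e \<in> border a}" by simp
  then obtain S where "S \<subseteq> {a\<in>A. e \<in> border a}" "card S = 3" by (meson obtain_subset_with_card_n)
  then obtain a1 a2 a3 where a: "{a1, a2, a3} \<subseteq> A" "e \<in> border a1" "e \<in> border a2" "e \<in> border a3"
    "a1 \<noteq> a2" "a1 \<noteq> a3" "a2 \<noteq> a3" by (auto simp: card_3_iff)
  let ?T = "img (E - {e})"
  have T: "img E = ?T \<union> path_image (\<gamma> e)" using e img_insert[of e "E - {e}"] by (simp add: insert_absorb)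
  have nin: "a \<notin> img E" if "a \<in> A" for a using A that by blast
  then have off: "a \<notin> path_image (\<gamma> e)" if "a \<in> A" for a using that T by blast
  have sep: "\<not> connected_component (- (?T \<union> path_image (\<gamma> e))) x y" if "x \<in> A" "y \<in> A" "x \<noteq> y" for x y
    using A that T by (metis pairwiseD)
  obtain x where x: "x \<in> path_image (\<gamma> e) - p ` e"
    using nonempty_simple_path_endless[OF arc_imp_simple_path[OF arc_edge[OF e]]] ends_edge[OF e] by auto
  \<comment> \<open>Without \<open>e\<close>, every face that it borders falls into the component
    around its inner point \<open>x\<close>.\<close>
  have con: "connected_component (- ?T) a x" if "a \<in> A" "e \<in> border a" for a
    using border_near_edge[OF that(2) nin[OF that(1)] x] .
  then have con2: "connected_component (- ?T) a b" if "a \<in> A" "e \<in> border a" "b \<in> A" "e \<in> border b" for a b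
    using that by (meson connected_component_sym connected_component_trans)
  obtain u v where uv: "e = {u, v}" "u \<noteq> v" "u \<in> V" "v \<in> V" "pathstart (\<gamma> e) = p u"
    "pathfinish (\<gamma> e) = p v" using edge_ends[OF e] by metis
  note arc = arc_edge[OF e]
  have Int: "path_image (\<gamma> e) \<inter> ?T = p ` (e \<inter> \<Union>(E - {e}))" using edge_Int_img[OF e, of "E - {e}"] by auto
  show False
  proof (cases "path_component ?T (p u) (p v)")
    case True
    then have "p u \<in> ?T" "p v \<in> ?T" using path_component_mem by blast+
    then have "path_image (\<gamma> e) \<inter> ?T = {pathstart (\<gamma> e), pathfinish (\<gamma> e)}"
      using Int uv ends_subset[OF e] by auto
    then show False
      using arc_at_most_two_sides[OF arc _ _ , of ?T a1 a2 a3] True uv(5,6) compact_img[of "E - {e}"]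
        off con2 a sep by (metis Diff_subset insert_subset)
  next
    case False
    \<comment> \<open>For a bridge \<open>e\<close> the other edges fall into those in the path
      component of \<open>p u\<close> and the rest; \<open>e\<close> meets each group in at most one
      point.\<close>
    define X1 where "X1 = {f \<in> E - {e}. path_image (\<gamma> f) \<inter> path_component_set ?T (p u) \<noteq> {}}"
    let ?X2 = "E - {e} - X1"
    have 1: "path_image (\<gamma> f) \<subseteq> path_component_set ?T (p u)" if "f \<in> X1" for f
    proof -
      have "path_image (\<gamma> f) \<inter> path_component_set ?T (p u) \<noteq> {}" using that by (simp add: X1_def)
      then obtain z where z: "z \<in> path_image (\<gamma> f)" "path_component ?T (p u) z" by auto
      have "path_image (\<gamma> f) \<subseteq> path_component_set ?T z"
        using that z arc_edge by (intro path_component_maximal path_connected_path_image arc_imp_path)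
          (auto simp: X1_def img_def)
      then show ?thesis using z(2) path_component_eq by (metis mem_Collect_eq)
    qed
    then have sub1: "img X1 \<subseteq> path_component_set ?T (p u)" by (auto simp: img_def)
    have sub2: "img ?X2 \<inter> path_component_set ?T (p u) = {}" by (auto simp: X1_def img_def)
    have dec: "?T = img X1 \<union> img ?X2" by (auto simp: X1_def img_def)
    have pu: "p u \<notin> img ?X2"
    proof
      assume *: "p u \<in> img ?X2"
      then have "p u \<in> ?T" using dec by blast
      then show False using sub2 * by (auto simp: path_component_refl_eq)
    qed
    have pv: "p v \<notin> img X1" using False sub1 by auto
    have "path_image (\<gamma> e) \<inter> ?T \<subseteq> {p u, p v}" using Int uv by auto
    then have "path_image (\<gamma> e) \<inter> img X1 \<subseteq> {p u}" "path_image (\<gamma> e) \<inter> img ?X2 \<subseteq> {p v}"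
      using pu pv dec by blast+
    then have "connected (path_image (\<gamma> e) \<inter> img X1)" "connected (path_image (\<gamma> e) \<inter> img ?X2)"
      by (metis connected_empty connected_sing subset_singletonD)+
    moreover have "compact (img X1)" "compact (img ?X2)"
      by (rule compact_img; force simp: X1_def)+
    moreover have "img X1 \<inter> img ?X2 = {}" using sub1 sub2 by blast
    ultimately have "connected_component (- (img X1 \<union> img ?X2 \<union> path_image (\<gamma> e))) a1 a2"
      using connected_component_Un_arc_bridge[OF arc, of "img X1" "img ?X2" a1 a2] con2[of a1 a2] off a dec
      by auto
    then show False using sep[of a1 a2] a dec by auto
  qed
qed

text \<open>Stated for an upper bound \<open>N \<ge> 3\<close>, since \<open>2 * card V - 4\<close>
  fails for a single edge and a part of a cover may miss vertices.\<close>

theorem card_edges_le: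
  assumes "card V \<le> N" "3 \<le> N"
  shows "card E \<le> 2 * N - 4"
proof (cases "V = {}")
  case True
  then have "E = {}" using edge_subset card_edge by fastforce
  then show ?thesis by simp
next
  case False
  obtain c :: "'a \<Rightarrow> 'a" and A where A: "separated E A" and "card E + 1 + card (c ` V) \<le> card A + card V"
    using euler_inequality[OF subset_refl] by blast
  moreover have "card (c ` V) \<noteq> 0" using False finite_V by simp
  ultimately have le: "card E + 2 \<le> card A + card V" by linarith
  show ?thesis
  proof (cases "card A \<le> 1")
    \<comment> \<open>With at most one representative there are at most \<open>N - 1\<close> edges,
      and \<open>N - 1 \<le> 2 * N - 4\<close> as \<open>3 \<le> N\<close>.\<close>
    case True
    then show ?thesis using le assms by linarith
  next
    case False
    have "4 \<le> card (border a)" if "a \<in> A" for a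
    proof -
      obtain b where b: "b \<in> A" "b \<noteq> a"
        using False A that by (metis card_le_Suc0_iff_eq One_nat_def)
      have "a \<notin> img E" "b \<notin> img E" using A b that by blast+
      moreover have "\<not> connected_component (- img E) a b" using A b that by (metis pairwiseD)
      ultimately show ?thesis by (rule border_at_least_4)
    qed
    then have "(\<Sum>a\<in>A. 4) \<le> (\<Sum>a\<in>A. card (border a))" by (rule sum_mono)
    also have "\<dots> = (\<Sum>a\<in>A. \<Sum>e\<in>{e\<in>E. e \<in> border a}. 1)"
      by (intro sum.cong refl) (auto simp: border_def intro!: arg_cong[where f = card])
    also have "\<dots> = (\<Sum>e\<in>E. \<Sum>a\<in>{a\<in>A. e \<in> border a}. 1)"
      using A finite_E by (intro sum.swap_restrict) auto
    also have "\<dots> \<le> (\<Sum>e\<in>E. 2)" using edge_borders_at_most_2[OF A] by (intro sum_mono) simp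
    finally have "4 * card A \<le> 2 * card E" by simp
    then show ?thesis using le assms by linarith
  qed
qed

end

section \<open>Lower bounds for covers of complete graphs\<close>

lemma girth_ge_4_imp_triangle_free:
  assumes "simple_graph G" "girth G \<ge> 4" "{u, v} \<in> edges G" "{v, w} \<in> edges G" "{u, w} \<in> edges G"
  shows False
proof -
  have "card {u, v} = 2" "card {v, w} = 2" "card {u, w} = 2"
    using assms unfolding simple_graph_def by blast+
  then have "u \<noteq> v" "v \<noteq> w" "u \<noteq> w" by auto
  moreover have "{w, u} \<in> edges G" using assms(5) by (simp add: insert_commute)
  ultimately have "is_cycle G [u, v, w]"
    using assms(3,4) unfolding is_cycle_def by (auto simp: numeral_2_eq_2 less_Suc_eq)
  then have "girth G \<le> enat (length [u, v, w])"
    unfolding girth_def by (intro INF_lower) simp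
  with assms(2) have "4 \<le> enat (length [u, v, w])" by (rule order_trans)
  then show False by (simp add: numeral_eq_enat)
qed

lemma triangle_free_imp_girth_ge_4:
  assumes "\<And>u v w. {u, v} \<in> edges G \<Longrightarrow> {v, w} \<in> edges G \<Longrightarrow> {u, w} \<in> edges G \<Longrightarrow> False"
  shows "girth G \<ge> 4"
  unfolding girth_def
proof (rule INF_greatest)
  fix c assume "c \<in> {c. is_cycle G c}"
  then have c: "is_cycle G c" by simp
  have "length c \<noteq> 3"
  proof
    assume "length c = 3"
    then obtain u v w where uvw: "c = [u, v, w]" by (auto simp: numeral_3_eq_3 length_Suc_conv)
    have "{c ! i, c ! (Suc i mod length c)} \<in> edges G" if "i < 3" for i
      using c that \<open>length c = 3\<close> by (simp add: is_cycle_def)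
    from this[of 0] this[of 1] this[of 2]
    have "{u, v} \<in> edges G" "{v, w} \<in> edges G" "{w, u} \<in> edges G"
      by (simp_all add: uvw numeral_2_eq_2)
    then show False using assms[of u v w] by (simp add: insert_commute)
  qed
  then have "4 \<le> length c" using c by (simp add: is_cycle_def)
  then show "4 \<le> enat (length c)" by (simp add: numeral_eq_enat)
qed

lemma planar_girth_4_card_edges:
  assumes "simple_graph G" "planar G" "girth G \<ge> 4" "card (verts G) \<le> N" "3 \<le> N"
  shows "card (edges G) \<le> 2 * N - 4"
proof -
  obtain p \<gamma> where "plane_drawing G p \<gamma>" using assms(2) by (auto simp: planar_def)
  then interpret drawn_triangle_free "verts G" "edges G" p \<gamma>
    using assms(1) girth_ge_4_imp_triangle_free[OF assms(1,3)]
    by unfold_locales (auto simp: plane_drawing_def simple_graph_def)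
  show ?thesis using card_edges_le assms(4,5) .
qed

lemma edges_complete_graph: "finite (edges (complete_graph n))" "card (edges (complete_graph n)) = n choose 2"
  using n_subsets[of "{..<n}" 2] by (auto simp: complete_graph_def)

lemma girth_cover_4_complete_graph_lower:
  assumes "girth_cover 4 (complete_graph n) k H" "1 \<le> n"
  shows "n + 2 \<le> 4 * k"
proof -
  have H: "simple_graph (H i)" "verts (H i) \<subseteq> {..<n}" "planar (H i)" "girth (H i) \<ge> 4" if "i < k" for i
    using assms(1) that by (auto simp: girth_cover_def subgraph_def complete_graph_def)
  have "(\<Union>i<k. verts (H i)) = {..<n}" using assms(1) by (simp add: girth_cover_def complete_graph_def)
  then have "0 \<in> (\<Union>i<k. verts (H i))" using assms(2) by simp
  then have k: "k \<noteq> 0" by auto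
  show ?thesis
  proof (cases "n \<le> 2")
    case True
    then show ?thesis using k by linarith
  next
    case False
    have "n choose 2 = card (\<Union>i<k. edges (H i))"
      using assms(1) by (simp add: girth_cover_def edges_complete_graph)
    also have "\<dots> \<le> (\<Sum>i<k. card (edges (H i)))" by (rule card_UN_le) simp
    also have "\<dots> \<le> (\<Sum>i<k. 2 * n - 4)"
    proof (rule sum_mono)
      fix i assume "i \<in> {..<k}"
      then show "card (edges (H i)) \<le> 2 * n - 4"
        using H[of i] card_mono[of "{..<n}" "verts (H i)"] False
        by (intro planar_girth_4_card_edges) auto
    qed
    finally have "n choose 2 \<le> k * (2 * n - 4)" by simp
    moreover have "even (n * (n - 1))" by (cases "even n") auto
    then have "2 * (n choose 2) = n * (n - 1)" by (simp add: choose_two)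
    moreover obtain m where "n = m + 3" using False by (metis add.commute le_add_diff_inverse not_less_eq_eq numeral_2_eq_2 numeral_3_eq_3)
    ultimately have "(m + 3) * (m + 2) \<le> 2 * (k * (2 * m + 2))" by simp
    \<comment> \<open>The product \<open>(m + 3) * (m + 2)\<close> exceeds
      \<open>(m + 1) * (m + 4)\<close> by 2. Strictness turns \<open>m + 4\<close>, which is
      \<open>n + 1\<close>, into the bound for \<open>n + 2\<close>.\<close>
    then have "(m + 1) * (m + 4) < (m + 1) * (4 * k)" by (simp add: algebra_simps)
    then have "m + 4 < 4 * k" by (simp only: mult_less_cancel1)
    then show ?thesis using \<open>n = m + 3\<close> by linarith
  qed
qed

lemma ramsey_3_3:
  fixes P :: "'a \<Rightarrow> 'a \<Rightarrow> bool"
  assumes "6 \<le> card V" and sym: "\<And>u v. P u v \<Longrightarrow> P v u"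
  obtains u v w where "{u, v, w} \<subseteq> V" "u \<noteq> v" "v \<noteq> w" "u \<noteq> w"
    "P u v \<and> P v w \<and> P u w \<or> \<not> P u v \<and> \<not> P v w \<and> \<not> P u w"
proof -
  have "finite V" using assms(1) card.infinite by fastforce
  obtain x where x: "x \<in> V" using assms(1) by fastforce
  define N where "N = (\<lambda>b. {y \<in> V - {x}. P x y = b})"
  have "N True \<union> N False = V - {x}" by (auto simp: N_def)
  moreover have "card (V - {x}) \<ge> 5" using x assms(1) by simp
  ultimately have "5 \<le> card (N True) + card (N False)" by (metis card_Un_le order_trans)
  then have "3 \<le> card (N True) \<or> 3 \<le> card (N False)" by linarith
  then obtain b where "3 \<le> card (N b)" by blast
  then obtain S where "S \<subseteq> N b" "card S = 3" by (meson obtain_subset_with_card_n)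
  then obtain u v w where uvw: "{u, v, w} \<subseteq> N b" "u \<noteq> v" "v \<noteq> w" "u \<noteq> w" by (auto simp: card_3_iff)
  show thesis
  proof (cases "P u v = b \<or> P v w = b \<or> P u w = b")
    case True
    then show thesis using that[of x u v] that[of x v w] that[of x u w] uvw x by (auto simp: N_def)
  next
    case False
    then show thesis using that[of u v w] uvw by (auto simp: N_def)
  qed
qed

text \<open>With two layers, membership in \<open>H 0\<close> colours the edges, and all others lie
  in \<open>H 1\<close>, so a monochromatic triangle lies in one layer.\<close>

lemma girth_cover_4_K6_lower:
  assumes "girth_cover 4 (complete_graph 6) k H"
  shows "3 \<le> k"
proof (rule ccontr)
  assume "\<not> 3 \<le> k"
  then have k: "i < k \<Longrightarrow> i = 0 \<or> i = 1" for i by linarith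
  have free: False if "i < k" "{u, v} \<in> edges (H i)" "{v, w} \<in> edges (H i)" "{u, w} \<in> edges (H i)" for i u v w
    using assms that girth_ge_4_imp_triangle_free[of "H i" u v w] by (auto simp: girth_cover_def subgraph_def)
  have cov: "\<exists>i<k. {u, v} \<in> edges (H i)" if "u < 6" "v < 6" "u \<noteq> v" for u v
  proof -
    have "{u, v} \<in> edges (complete_graph 6)" using that by (auto simp: complete_graph_def)
    then show ?thesis using assms by (auto simp: girth_cover_def)
  qed
  obtain u v w where uvw: "{u, v, w} \<subseteq> {..<6::nat}" "u \<noteq> v" "v \<noteq> w" "u \<noteq> w"
    "({u, v} \<in> edges (H 0) \<and> {v, w} \<in> edges (H 0) \<and> {u, w} \<in> edges (H 0)) \<or>
     ({u, v} \<notin> edges (H 0) \<and> {v, w} \<notin> edges (H 0) \<and> {u, w} \<notin> edges (H 0))"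
    using ramsey_3_3[of "{..<6::nat}" "\<lambda>u v. {u, v} \<in> edges (H 0)"] by (auto simp: insert_commute)
  from uvw(5) show False
  proof
    assume *: "{u, v} \<in> edges (H 0) \<and> {v, w} \<in> edges (H 0) \<and> {u, w} \<in> edges (H 0)"
    have "0 < k" using cov[of 0 1] by auto
    then show False using free[of 0 u v w] * by blast
  next
    assume *: "{u, v} \<notin> edges (H 0) \<and> {v, w} \<notin> edges (H 0) \<and> {u, w} \<notin> edges (H 0)"
    have "\<exists>i<k. {a, b} \<in> edges (H i)" if "a \<in> {u, v, w}" "b \<in> {u, v, w}" "a \<noteq> b" for a b
      using cov that uvw(1) by blast
    then have "1 < k \<and> {u, v} \<in> edges (H 1)" "1 < k \<and> {v, w} \<in> edges (H 1)" "1 < k \<and> {u, w} \<in> edges (H 1)"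
      using * k uvw(2-4) by (metis insertCI)+
    then show False using free[of 1 u v w] by blast
  qed
qed

section \<open>Drawings on the coordinate axes\<close>

text \<open>A straight-line drawing with the vertices at nonzero integer points of the coordinate axes.
  Edges within an axis join neighbouring integers, apart from a possible edge through the origin;
  \<open>nested\<close> keeps two edges inside the same quadrant from crossing.\<close>

locale axis_drawing =
  fixes V :: "'a set" and R :: "'a \<Rightarrow> 'a \<Rightarrow> bool" and h g :: "'a \<Rightarrow> int"
  assumes inj: "u \<in> V \<Longrightarrow> v \<in> V \<Longrightarrow> h u = h v \<Longrightarrow> g u = g v \<Longrightarrow> u = v"
    and on_axis: "v \<in> V \<Longrightarrow> (h v = 0) \<noteq> (g v = 0)"
    and edge_type: "u \<in> V \<Longrightarrow> v \<in> V \<Longrightarrow> R u v \<Longrightarrow>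
      g u = 0 \<and> h v = 0 \<or>
      g u = 0 \<and> g v = 0 \<and> h v = h u + 1 \<or>
      h u = 0 \<and> h v = 0 \<and> g u = -1 \<and> g v = 1"
    and nested: "u \<in> V \<Longrightarrow> v \<in> V \<Longrightarrow> u' \<in> V \<Longrightarrow> v' \<in> V \<Longrightarrow> R u v \<Longrightarrow> R u' v' \<Longrightarrow>
      h u * h u' > 0 \<Longrightarrow> g v * g v' > 0 \<Longrightarrow> \<bar>h u\<bar> < \<bar>h u'\<bar> \<Longrightarrow> \<bar>g v\<bar> \<le> \<bar>g v'\<bar>"
begin

definition pos :: "'a \<Rightarrow> complex" where
  "pos v = Complex (of_int (h v)) (of_int (g v))"

abbreviation seg :: "'a \<Rightarrow> 'a \<Rightarrow> complex set" where
  "seg u v \<equiv> closed_segment (pos u) (pos v)"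

lemma pos_inj: "u \<in> V \<Longrightarrow> v \<in> V \<Longrightarrow> pos u = pos v \<Longrightarrow> u = v"
  using inj by (auto simp: pos_def)

lemma segD:
  assumes "z \<in> seg u v"
  obtains l :: real where "0 \<le> l" "l \<le> 1" "Re z = (1 - l) * h u + l * h v" "Im z = (1 - l) * g u + l * g v"
  using assms by (auto simp: closed_segment_def pos_def)

lemma cross_segD:
  assumes "g u = 0" "h v = 0" "z \<in> seg u v"
  obtains l :: real where "0 \<le> l" "l \<le> 1" "Re z = (1 - l) * h u" "Im z = l * g v"
  using segD[OF assms(3)] assms(1,2) by auto

lemma cross_seg_on_axis:
  assumes "u \<in> V" "v \<in> V" "g u = 0" "h v = 0" "z \<in> seg u v"
  shows "Im z = 0 \<Longrightarrow> z = pos u" "Re z = 0 \<Longrightarrow> z = pos v"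
proof -
  obtain l :: real where l: "Re z = (1 - l) * h u" "Im z = l * g v"
    using cross_segD[OF assms(3-5)] by metis
  have nz: "h u \<noteq> 0" "g v \<noteq> 0" using on_axis assms by auto
  show "z = pos u" if "Im z = 0" using that l nz assms by (simp add: pos_def complex_eq_iff)
  show "z = pos v" if "Re z = 0" using that l nz assms by (simp add: pos_def complex_eq_iff)
qed

lemma horizontal_segD:
  assumes "g u = 0" "g v = 0" "h v = h u + 1" "z \<in> seg u v"
  shows "Im z = 0" "of_int (h u) \<le> Re z" "Re z \<le> of_int (h u) + 1"
proof -
  obtain l :: real where "0 \<le> l" "l \<le> 1" "Re z = (1 - l) * h u + l * h v" "Im z = (1 - l) * g u + l * g v"
    using segD[OF assms(4)] .
  then show "Im z = 0" "of_int (h u) \<le> Re z" "Re z \<le> of_int (h u) + 1"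
    using assms(1-3) by (auto simp: algebra_simps)
qed

lemma vertical_segD:
  assumes "h u = 0" "h v = 0" "g u = -1" "g v = 1" "z \<in> seg u v"
  shows "Re z = 0" "-1 \<le> Im z" "Im z \<le> 1"
proof -
  obtain l :: real where "0 \<le> l" "l \<le> 1" "Re z = (1 - l) * h u + l * h v" "Im z = (1 - l) * g u + l * g v"
    using segD[OF assms(5)] .
  then show "Re z = 0" "-1 \<le> Im z" "Im z \<le> 1"
    using assms(1-4) by (auto simp: algebra_simps)
qed

text \<open>A unit segment between integers has no integer point inside, and the vertical edge from
  -1 to 1 only the origin, which is no vertex.\<close>

lemma vertex_on_seg:
  assumes "u \<in> V" "v \<in> V" "w \<in> V" "R u v" "pos w \<in> seg u v"
  shows "w = u \<or> w = v"
  using edge_type[OF assms(1,2,4)]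
proof (elim disjE conjE)
  assume "g u = 0" "h v = 0"
  then show ?thesis
    using cross_seg_on_axis[of u v "pos w"] assms on_axis[of w] pos_inj by (auto simp: pos_def)
next
  assume *: "g u = 0" "g v = 0" "h v = h u + 1"
  have "g w = 0" "h w = h u \<or> h w = h v"
    using horizontal_segD[OF * assms(5)] * by (auto simp: pos_def)
  then show ?thesis using inj[of w u] inj[of w v] assms * by auto
next
  assume *: "h u = 0" "h v = 0" "g u = -1" "g v = 1"
  have "h w = 0" "-1 \<le> g w" "g w \<le> 1"
    using vertical_segD[OF * assms(5)] by (auto simp: pos_def)
  moreover have "g w \<noteq> 0" using on_axis[of w] assms(3) \<open>h w = 0\<close> by auto
  ultimately have "h w = 0" "g w = -1 \<or> g w = 1" by auto
  then show ?thesis using inj[of w u] inj[of w v] assms * by auto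
qed

text \<open>Comparing the parameters of a common point,
  \<open>\<bar>h u\<bar> < \<bar>h u'\<bar>\<close> gives \<open>l < l'\<close>, whereas
  \<open>nested\<close> gives \<open>l' \<le> l\<close>. Used in both directions, this leaves only
  equal segments.\<close>

lemma nested_cross_segs_disjoint:
  assumes "u \<in> V" "v \<in> V" "u' \<in> V" "v' \<in> V" "R u v" "R u' v'"
    "g u = 0" "h v = 0" "g u' = 0" "h v' = 0"
    and z: "z \<in> seg u v" "z \<in> seg u' v'" "Re z \<noteq> 0" "Im z \<noteq> 0"
  shows "\<not> \<bar>h u\<bar> < \<bar>h u'\<bar>"
    and "h u * h u' > 0" "g v * g v' > 0" "\<bar>h u\<bar> = \<bar>h u'\<bar> \<Longrightarrow> \<bar>g v\<bar> = \<bar>g v'\<bar>"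
proof -
  obtain l :: real where l: "0 \<le> l" "l \<le> 1" "Re z = (1 - l) * h u" "Im z = l * g v"
    using cross_segD z(1) assms by metis
  obtain l' :: real where l': "0 \<le> l'" "l' \<le> 1" "Re z = (1 - l') * h u'" "Im z = l' * g v'"
    using cross_segD z(2) assms by metis
  have pos: "0 < l" "l < 1" "0 < l'" "l' < 1" using l l' z(3,4) by (auto simp: less_le)
  have X: "(1 - l) * real_of_int (h u) = (1 - l') * real_of_int (h u')" and Y: "l * real_of_int (g v) = l' * real_of_int (g v')"
    using l l' by auto
  have nz: "h u \<noteq> 0" "h u' \<noteq> 0" "g v \<noteq> 0" "g v' \<noteq> 0" using z(3,4) l l' by auto
  have "0 < ((1 - l) * real_of_int (h u)) * ((1 - l') * real_of_int (h u'))"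
    unfolding X  using l'(3) z(3) by (metis not_real_square_gt_zero)
  then have "0 < ((1 - l) * (1 - l')) * (real_of_int (h u) * real_of_int (h u'))" by (simp add: algebra_simps)
  then have "0 < real_of_int (h u) * real_of_int (h u')"
    by (rule zero_less_mult_pos) (use pos in simp)
  then have "0 < real_of_int (h u * h u')" by simp
  then show hh: "h u * h u' > 0" by linarith
  have "0 < (l * real_of_int (g v)) * (l' * real_of_int (g v'))"
    unfolding Y using l'(4) z(4) by (metis not_real_square_gt_zero)
  then have "0 < (l * l') * (real_of_int (g v) * real_of_int (g v'))" by (simp add: algebra_simps)
  then have "0 < real_of_int (g v) * real_of_int (g v')"
    by (rule zero_less_mult_pos) (use pos in simp)
  then have "0 < real_of_int (g v * g v')" by simp
  then show gg: "g v * g v' > 0" by linarith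
  have aX: "(1 - l) * \<bar>h u\<bar> = (1 - l') * \<bar>h u'\<bar>" and aY: "l * \<bar>g v\<bar> = l' * \<bar>g v'\<bar>"
    using arg_cong[OF X, of abs] arg_cong[OF Y, of abs] pos by (auto simp: abs_mult)
  show "\<not> \<bar>h u\<bar> < \<bar>h u'\<bar>"
  proof
    assume lt: "\<bar>h u\<bar> < \<bar>h u'\<bar>"
    then have "\<bar>g v\<bar> \<le> \<bar>g v'\<bar>" using nested assms(1-6) hh gg by blast
    then have "l * real_of_int \<bar>g v\<bar> \<le> l * real_of_int \<bar>g v'\<bar>" using pos by (intro mult_left_mono) auto
    then have "l' * real_of_int \<bar>g v'\<bar> \<le> l * real_of_int \<bar>g v'\<bar>" using aY by simp
    then have "l' \<le> l" using nz(4) by (simp add: mult_le_cancel_right)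
    have "(1 - l) * real_of_int \<bar>h u\<bar> < (1 - l) * real_of_int \<bar>h u'\<bar>"
      using lt pos by (intro mult_strict_left_mono) auto
    then have "(1 - l') * real_of_int \<bar>h u'\<bar> < (1 - l) * real_of_int \<bar>h u'\<bar>" using aX by simp
    then have "1 - l' < 1 - l" using nz(2) by (simp add: mult_less_cancel_right)
    then show False using \<open>l' \<le> l\<close> by simp
  qed
  show "\<bar>g v\<bar> = \<bar>g v'\<bar>" if "\<bar>h u\<bar> = \<bar>h u'\<bar>"
  proof -
    have "l = l'" using aX that nz(2) by simp
    then have "real_of_int \<bar>g v\<bar> = real_of_int \<bar>g v'\<bar>" using aY pos by simp
    then show ?thesis by linarith
  qed
qed

lemma cross_segs_meet:
  assumes "u \<in> V" "v \<in> V" "u' \<in> V" "v' \<in> V" "R u v" "R u' v'"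
    "g u = 0" "h v = 0" "g u' = 0" "h v' = 0" "{u, v} \<noteq> {u', v'}"
    and z: "z \<in> seg u v" "z \<in> seg u' v'"
  shows "z \<in> pos ` ({u, v} \<inter> {u', v'})"
proof -
  consider "Re z = 0" | "Im z = 0" | "Re z \<noteq> 0" "Im z \<noteq> 0" by blast
  then show ?thesis
  proof cases
    case 1
    then have "z = pos v" "z = pos v'"
      using cross_seg_on_axis(2)[OF assms(1,2,7,8) z(1)] cross_seg_on_axis(2)[OF assms(3,4,9,10) z(2)]
      by blast+
    then show ?thesis using pos_inj[OF assms(2,4)] by simp
  next
    case 2
    then have "z = pos u" "z = pos u'"
      using cross_seg_on_axis(1)[OF assms(1,2,7,8) z(1)] cross_seg_on_axis(1)[OF assms(3,4,9,10) z(2)]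
      by blast+
    then show ?thesis using pos_inj[OF assms(1,3)] by simp
  next
    case 3
    note * = nested_cross_segs_disjoint[OF assms(1-10) z 3]
    have "\<not> \<bar>h u'\<bar> < \<bar>h u\<bar>"
      using nested_cross_segs_disjoint(1)[OF assms(3,4,1,2,6,5,9,10,7,8) z(2,1) 3] .
    then have "\<bar>h u\<bar> = \<bar>h u'\<bar>" using *(1) by simp
    moreover from this have "\<bar>g v\<bar> = \<bar>g v'\<bar>" using *(4) by blast
    moreover have "h u * h u' > 0" "g v * g v' > 0" using *(2,3) .
    ultimately have "h u = h u'" "g v = g v'" by (auto simp: abs_eq_iff zero_less_mult_iff)
    then have "u = u'" "v = v'" using inj assms by auto
    then show ?thesis using assms by simp
  qed
qed

lemma segs_meet:
  assumes V: "u \<in> V" "v \<in> V" "u' \<in> V" "v' \<in> V" and R: "R u v" "R u' v'"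
    and ne: "{u, v} \<noteq> {u', v'}" and z: "z \<in> seg u v" "z \<in> seg u' v'"
  shows "z \<in> pos ` ({u, v} \<inter> {u', v'})"
proof -
  have cross_other: "z \<in> pos ` ({a, b} \<inter> {c, d})"
    if "a \<in> V" "b \<in> V" "c \<in> V" "d \<in> V" "R c d" "g a = 0" "h b = 0"
      "z \<in> seg a b" "z \<in> seg c d" "Re z = 0 \<or> Im z = 0" for a b c d
  proof -
    have "z = pos a \<or> z = pos b" using cross_seg_on_axis[OF that(1,2,6,7,8)] that(10) by blast
    then show ?thesis using vertex_on_seg[of c d] that by fastforce
  qed
  have horizontal: "z \<in> pos ` ({a, b} \<inter> {c, d})"
    if "a \<in> V" "b \<in> V" "c \<in> V" "d \<in> V" "g a = 0" "g b = 0" "h b = h a + 1"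
      "g c = 0" "g d = 0" "h d = h c + 1" "h a < h c" "z \<in> seg a b" "z \<in> seg c d" for a b c d
  proof -
    have "real_of_int (h a + 1) \<le> real_of_int (h c)" using that(11) by linarith
    then have "Re z = h c" "h b = h c" "Im z = 0"
      using horizontal_segD[OF that(5-7,12)] horizontal_segD[OF that(8-10,13)] that(7) by linarith+
    moreover have "b = c" using inj that \<open>h b = h c\<close> by auto
    ultimately have "z = pos c" using that by (simp add: pos_def complex_eq_iff)
    then show ?thesis using \<open>b = c\<close> by simp
  qed
  \<comment> \<open>A horizontal edge through the origin would have an integer end there, but the
    origin is no vertex.\<close>
  have perpendicular: False
    if "a \<in> V" "b \<in> V" "g a = 0" "g b = 0" "h b = h a + 1" "z \<in> seg a b" "Re z = 0" for a b
  proof -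
    have "h a = 0 \<or> h b = 0" using horizontal_segD[OF that(3-6)] that by linarith
    then show False using on_axis that by auto
  qed
  consider (cross) "g u = 0" "h v = 0" | (hor) "g u = 0" "g v = 0" "h v = h u + 1"
    | (vert) "h u = 0" "h v = 0" "g u = -1" "g v = 1" using edge_type[OF V(1,2) R(1)] by blast
  note uv = this
  consider (cross) "g u' = 0" "h v' = 0" | (hor) "g u' = 0" "g v' = 0" "h v' = h u' + 1"
    | (vert) "h u' = 0" "h v' = 0" "g u' = -1" "g v' = 1" using edge_type[OF V(3,4) R(2)] by blast
  note uv' = this
  show ?thesis
  proof (cases rule: uv)
    case cross
    note c = this
    show ?thesis
    proof (cases rule: uv')
      case cross
      then show ?thesis using cross_segs_meet[OF V R c _ _ ne z] by blast
    next
      case hor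
      then show ?thesis using cross_other[OF V R(2) c z] horizontal_segD(1)[OF _ _ _ z(2)] by blast
    next
      case vert
      then show ?thesis using cross_other[OF V R(2) c z] vertical_segD(1)[OF _ _ _ _ z(2)] by blast
    qed
  next
    case hor
    note c = this
    show ?thesis
    proof (cases rule: uv')
      case cross
      then show ?thesis
        using cross_other[OF V(3,4,1,2) R(1) cross z(2,1)] horizontal_segD(1)[OF c z(1)] by blast
    next
      case hor
      then have "h u \<noteq> h u'" using inj[OF V(1,3)] inj[OF V(2,4)] c ne by auto
      then consider "h u < h u'" | "h u' < h u" by linarith
      then show ?thesis
        using horizontal[OF V c hor _ z] horizontal[OF V(3,4,1,2) hor c _ z(2,1)]
        by cases (simp_all add: Int_commute)
    next
      case vert
      then show ?thesis using perpendicular[OF V(1,2) c z(1)] vertical_segD(1)[OF vert z(2)] by blast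
    qed
  next
    case vert
    note c = this
    show ?thesis
    proof (cases rule: uv')
      case cross
      then show ?thesis
        using cross_other[OF V(3,4,1,2) R(1) cross z(2,1)] vertical_segD(1)[OF c z(1)] by blast
    next
      case hor
      then show ?thesis using perpendicular[OF V(3,4) hor z(2)] vertical_segD(1)[OF c z(1)] by blast
    next
      case vert
      then show ?thesis using inj[OF V(1,3)] inj[OF V(2,4)] c ne by auto
    qed
  qed
qed

definition graph :: "'a sgraph" where
  "graph = \<lparr>verts = V, edges = {{u, v} | u v. u \<in> V \<and> v \<in> V \<and> R u v}\<rparr>"

lemma planar_graph: "planar graph"
proof -
  \<comment> \<open>Edges are unordered, whereas \<open>R\<close> is directed, naming the end on the
    horizontal axis first if an edge joins the two axes. \<open>S\<close> picks a direction in which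
    \<open>R\<close> holds.\<close>
  define S where "S = (\<lambda>e. SOME (u, v). e = {u, v} \<and> u \<in> V \<and> v \<in> V \<and> R u v)"
  define \<gamma> where "\<gamma> = (\<lambda>e. linepath (pos (fst (S e))) (pos (snd (S e))))"
  have \<gamma>: "\<exists>u v. e = {u, v} \<and> u \<in> V \<and> v \<in> V \<and> R u v \<and> \<gamma> e = linepath (pos u) (pos v)"
    if "e \<in> edges graph" for e
  proof -
    have "\<exists>x. case x of (u, v) \<Rightarrow> e = {u, v} \<and> u \<in> V \<and> v \<in> V \<and> R u v"
      using that by (auto simp: graph_def)
    then have "case S e of (u, v) \<Rightarrow> e = {u, v} \<and> u \<in> V \<and> v \<in> V \<and> R u v"
      unfolding S_def by (rule someI_ex)
    then show ?thesis by (auto simp: \<gamma>_def split: prod.splits)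
  qed
  have irrefl: "u \<noteq> v" if "u \<in> V" "v \<in> V" "R u v" for u v
    using edge_type[OF that] on_axis[OF that(1)] by auto
  have "plane_drawing graph pos \<gamma>"
    unfolding plane_drawing_def
  proof (intro conjI ballI impI)
    show "inj_on pos (verts graph)" using pos_inj by (auto simp: graph_def inj_on_def)
  next
    fix e assume "e \<in> edges graph"
    then obtain u v where e: "e = {u, v}" "u \<in> V" "v \<in> V" "R u v" "\<gamma> e = linepath (pos u) (pos v)"
      using \<gamma> by blast
    have "pos u \<noteq> pos v" using e irrefl[of u v] pos_inj[of u v] by blast
    then show "arc (\<gamma> e)" using e by simp
    show "{pathstart (\<gamma> e), pathfinish (\<gamma> e)} = pos ` e" using e by simp
    show "path_image (\<gamma> e) \<inter> pos ` verts graph = pos ` e"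
    proof
      show "path_image (\<gamma> e) \<inter> pos ` verts graph \<subseteq> pos ` e"
        using e vertex_on_seg[of u v] by (auto simp: graph_def)
      show "pos ` e \<subseteq> path_image (\<gamma> e) \<inter> pos ` verts graph" using e by (auto simp: graph_def)
    qed
  next
    fix e f assume "e \<in> edges graph" "f \<in> edges graph" "e \<noteq> f"
    then obtain u v u' v' where e: "e = {u, v}" "u \<in> V" "v \<in> V" "R u v" "\<gamma> e = linepath (pos u) (pos v)"
      and f: "f = {u', v'}" "u' \<in> V" "v' \<in> V" "R u' v'" "\<gamma> f = linepath (pos u') (pos v')"
      using \<gamma> by meson
    show "path_image (\<gamma> e) \<inter> path_image (\<gamma> f) = pos ` (e \<inter> f)"
    proof
      show "path_image (\<gamma> e) \<inter> path_image (\<gamma> f) \<subseteq> pos ` (e \<inter> f)"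
        using segs_meet[of u v u' v'] e f \<open>e \<noteq> f\<close> by auto
      have "pos ` e \<subseteq> path_image (\<gamma> e)" "pos ` f \<subseteq> path_image (\<gamma> f)" using e f by auto
      then show "pos ` (e \<inter> f) \<subseteq> path_image (\<gamma> e) \<inter> path_image (\<gamma> f)" by blast
    qed
  qed
  then show ?thesis by (auto simp: planar_def)
qed

end

section \<open>Layers and the covers made of them\<close>

definition layer :: "'a set \<Rightarrow> ('a \<Rightarrow> 'a \<Rightarrow> bool) \<Rightarrow> bool" where
  "layer V R \<longleftrightarrow> (\<exists>h g. axis_drawing V R h g) \<and>
     (\<forall>u\<in>V. \<forall>v\<in>V. \<forall>w\<in>V. \<not> ((R u v \<or> R v u) \<and> (R v w \<or> R w v) \<and> (R u w \<or> R w u)))"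

text \<open>A bipartite graph has no triangle. \<open>layer\<close> demands only the latter, because
  5-cycles also occur as layers.\<close>

lemma layer_of_2_colouring:
  fixes col :: "'a \<Rightarrow> bool"
  assumes "axis_drawing V R h g" "\<And>u v. u \<in> V \<Longrightarrow> v \<in> V \<Longrightarrow> R u v \<Longrightarrow> col u \<noteq> col v"
  shows "layer V R"
  unfolding layer_def using assms by blast

text \<open>All conditions on a layer are universal over vertices and pass to any subset. So a
  family of layers also serves all smaller complete graphs.\<close>

lemma layer_subgraph:
  assumes L: "layer V R" and f: "inj_on f {..<n}" "f ` {..<n} \<subseteq> V"
  shows "\<exists>H. subgraph H (complete_graph n) \<and> planar H \<and> girth H \<ge> 4 \<and> verts H = {..<n} \<and>
    edges H = {{a, b} | a b. a < n \<and> b < n \<and> R (f a) (f b)}"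
proof -
  obtain h g where "axis_drawing V R h g" using L by (auto simp: layer_def)
  then interpret V: axis_drawing V R h g .
  interpret N: axis_drawing "{..<n}" "\<lambda>a b. R (f a) (f b)" "h \<circ> f" "g \<circ> f"
  proof
    fix u v assume "u \<in> {..<n}" "v \<in> {..<n}" "(h \<circ> f) u = (h \<circ> f) v" "(g \<circ> f) u = (g \<circ> f) v"
    then show "u = v" using V.inj[of "f u" "f v"] f by (auto dest: inj_onD)
  next
    fix v assume "v \<in> {..<n}"
    then show "((h \<circ> f) v = 0) \<noteq> ((g \<circ> f) v = 0)" using V.on_axis[of "f v"] f(2) by auto
  next
    fix u v assume "u \<in> {..<n}" "v \<in> {..<n}" "R (f u) (f v)"
    then show "(g \<circ> f) u = 0 \<and> (h \<circ> f) v = 0 \<or>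
      (g \<circ> f) u = 0 \<and> (g \<circ> f) v = 0 \<and> (h \<circ> f) v = (h \<circ> f) u + 1 \<or>
      (h \<circ> f) u = 0 \<and> (h \<circ> f) v = 0 \<and> (g \<circ> f) u = - 1 \<and> (g \<circ> f) v = 1"
      using V.edge_type[of "f u" "f v"] f(2) by auto
  next
    fix u v u' v' assume "u \<in> {..<n}" "v \<in> {..<n}" "u' \<in> {..<n}" "v' \<in> {..<n}"
      "R (f u) (f v)" "R (f u') (f v')" "(h \<circ> f) u * (h \<circ> f) u' > 0" "(g \<circ> f) v * (g \<circ> f) v' > 0"
      "\<bar>(h \<circ> f) u\<bar> < \<bar>(h \<circ> f) u'\<bar>"
    then show "\<bar>(g \<circ> f) v\<bar> \<le> \<bar>(g \<circ> f) v'\<bar>"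
      using V.nested[of "f u" "f v" "f u'" "f v'"] f(2) by auto
  qed
  let ?adj = "\<lambda>a b. R (f a) (f b) \<or> R (f b) (f a)"
  have adj: "a < n \<and> b < n \<and> ?adj a b" if "{a, b} \<in> edges N.graph" for a b
    using that by (auto simp: N.graph_def doubleton_eq_iff)
  have "girth N.graph \<ge> 4"
  proof (rule triangle_free_imp_girth_ge_4)
    fix u v w assume "{u, v} \<in> edges N.graph" "{v, w} \<in> edges N.graph" "{u, w} \<in> edges N.graph"
    then have *: "f u \<in> V" "f v \<in> V" "f w \<in> V" "?adj u v" "?adj v w" "?adj u w"
      using adj[of u v] adj[of v w] adj[of u w] f(2) by auto
    show False using L * unfolding layer_def by blast
  qed
  moreover have "subgraph N.graph (complete_graph n)"
  proof -
    have "card e = 2 \<and> e \<subseteq> {..<n}" if "e \<in> edges N.graph" for e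
    proof -
      obtain a b where e: "e = {a, b}" "a < n" "b < n" "R (f a) (f b)"
        using \<open>e \<in> edges N.graph\<close> by (auto simp: N.graph_def)
      then have "a \<noteq> b" using N.edge_type[of a b] N.on_axis[of a] by auto
      then show ?thesis using e by simp
    qed
    then show ?thesis by (auto simp: subgraph_def simple_graph_def complete_graph_def N.graph_def)
  qed
  ultimately show ?thesis
    using N.planar_graph by (intro exI[of _ N.graph]) (auto simp: N.graph_def)
qed

lemma girth_cover_of_layers:
  assumes "n \<le> card V" "1 \<le> n" "1 \<le> k" "\<And>i. i < k \<Longrightarrow> layer V (R i)"
    and cov: "\<And>u v. u \<in> V \<Longrightarrow> v \<in> V \<Longrightarrow> u \<noteq> v \<Longrightarrow> \<exists>i<k. R i u v \<or> R i v u"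
  shows "\<exists>H. girth_cover 4 (complete_graph n) k H"
proof -
  have "finite V" using assms(1,2) card.infinite by fastforce
  then obtain f where f: "inj_on f {..<n}" "f ` {..<n} \<subseteq> V"
    using card_le_inj[of "{..<n}" V] assms(1) by auto
  let ?P = "\<lambda>i H. subgraph H (complete_graph n) \<and> planar H \<and> girth H \<ge> 4 \<and>
    verts H = {..<n} \<and> edges H = {{a, b} | a b. a < n \<and> b < n \<and> R i (f a) (f b)}"
  have "\<forall>i\<in>{..<k}. \<exists>H. ?P i H" using layer_subgraph[OF assms(4) f] by simp
  from bchoice[OF this] obtain H where "\<forall>i\<in>{..<k}. ?P i (H i)" ..
  then have H: "?P i (H i)" if "i < k" for i using that by simp
  have "(\<Union>i<k. verts (H i)) = verts (complete_graph n)"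
    using H assms(3) by (force simp: complete_graph_def)
  moreover have "edges (complete_graph n) \<subseteq> (\<Union>i<k. edges (H i))"
  proof
    fix e assume "e \<in> edges (complete_graph n)"
    then obtain a b where e: "e = {a, b}" "a \<noteq> b" "a < n" "b < n"
      by (auto simp: complete_graph_def card_2_iff)
    then have "f a \<noteq> f b" "f a \<in> V" "f b \<in> V" using f inj_on_eq_iff[OF f(1), of a b] by auto
    then obtain i where i: "i < k" "R i (f a) (f b) \<or> R i (f b) (f a)" using cov by blast
    have "e = {b, a}" using e by auto
    then have "\<exists>a b. e = {a, b} \<and> a < n \<and> b < n \<and> R i (f a) (f b)" using i(2) e by metis
    then have "e \<in> edges (H i)" using H[OF i(1)] by simp
    then show "e \<in> (\<Union>i<k. edges (H i))" using i(1) by blast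
  qed
  moreover have "(\<Union>i<k. edges (H i)) \<subseteq> edges (complete_graph n)"
  proof (rule UN_least)
    show "edges (H i) \<subseteq> edges (complete_graph n)" if "i \<in> {..<k}" for i
      using H[of i] that unfolding subgraph_def by blast
  qed
  ultimately have "girth_cover 4 (complete_graph n) k H" using H by (simp add: girth_cover_def)
  then show ?thesis by blast
qed

section \<open>Small complete graphs, checked by evaluation\<close>

definition list_drawing :: "int list \<Rightarrow> int list \<Rightarrow> (nat \<times> nat) list \<Rightarrow> bool" where
  "list_drawing hs gs es \<longleftrightarrow>
     distinct (zip hs gs) \<and> length hs = length gs \<and> list_all (\<lambda>(a, b). (a = 0) \<noteq> (b = 0)) (zip hs gs) \<and>
     list_all (\<lambda>(u, v). u < length hs \<and> v < length hs \<and>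
      (gs ! u = 0 \<and> hs ! v = 0 \<or> gs ! u = 0 \<and> gs ! v = 0 \<and> hs ! v = hs ! u + 1)) es \<and>
     list_all (\<lambda>(u, v). list_all (\<lambda>(u', v'). hs ! u * hs ! u' > 0 \<and> gs ! v * gs ! v' > 0 \<and>
        \<bar>hs ! u\<bar> < \<bar>hs ! u'\<bar> \<longrightarrow> \<bar>gs ! v\<bar> \<le> \<bar>gs ! v'\<bar>) es) es \<and>
     list_all (\<lambda>(u, v). list_all (\<lambda>w. \<not> (((v, w) \<in> set es \<or> (w, v) \<in> set es) \<and>
        ((u, w) \<in> set es \<or> (w, u) \<in> set es))) [0..<length hs]) es"

lemma layer_of_list_drawing:
  assumes "list_drawing hs gs es" "n = length hs"
  shows "layer {..<n} (\<lambda>u v. (u, v) \<in> set es)"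
proof -
  note D = assms(1)[unfolded list_drawing_def, folded assms(2)]
  from D have L: "length gs = n" "distinct (zip hs gs)" by auto
  from D have 1: "list_all (\<lambda>(a, b). (a = 0) \<noteq> (b = 0)) (zip hs gs)"
    and 2: "list_all (\<lambda>(u, v). u < n \<and> v < n \<and>
      (gs ! u = 0 \<and> hs ! v = 0 \<or> gs ! u = 0 \<and> gs ! v = 0 \<and> hs ! v = hs ! u + 1)) es"
    and 3: "list_all (\<lambda>(u, v). list_all (\<lambda>(u', v'). hs ! u * hs ! u' > 0 \<and> gs ! v * gs ! v' > 0 \<and>
        \<bar>hs ! u\<bar> < \<bar>hs ! u'\<bar> \<longrightarrow> \<bar>gs ! v\<bar> \<le> \<bar>gs ! v'\<bar>) es) es"
    and 4: "list_all (\<lambda>(u, v). list_all (\<lambda>w. \<not> (((v, w) \<in> set es \<or> (w, v) \<in> set es) \<and>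
        ((u, w) \<in> set es \<or> (w, u) \<in> set es))) [0..<n]) es"
    by blast+
  have ax: "(hs ! v = 0) \<noteq> (gs ! v = 0)" if "v < n" for v
    using 1 L(1) assms(2) that by (auto simp: list_all_length)
  have edge: "u < n \<and> v < n \<and>
      (gs ! u = 0 \<and> hs ! v = 0 \<or> gs ! u = 0 \<and> gs ! v = 0 \<and> hs ! v = hs ! u + 1)" if "(u, v) \<in> set es" for u v
    using 2[unfolded list_all_iff, THEN bspec, OF that] by simp
  have nest: "\<bar>gs ! v\<bar> \<le> \<bar>gs ! v'\<bar>" if "(u, v) \<in> set es" "(u', v') \<in> set es"
     "hs ! u * hs ! u' > 0" "gs ! v * gs ! v' > 0" "\<bar>hs ! u\<bar> < \<bar>hs ! u'\<bar>" for u v u' v'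
    using 3[unfolded list_all_iff, THEN bspec, OF that(1)] that(2-5) by force
  have tri: "\<not> (((v, w) \<in> set es \<or> (w, v) \<in> set es) \<and> ((u, w) \<in> set es \<or> (w, u) \<in> set es))"
    if "(u, v) \<in> set es" "w < n" for u v w
    using 4[unfolded list_all_iff, THEN bspec, OF that(1)] that(2) by simp
  have "axis_drawing {..<n} (\<lambda>u v. (u, v) \<in> set es) ((!) hs) ((!) gs)"
  proof
    fix u v assume "u \<in> {..<n}" "v \<in> {..<n}" "hs ! u = hs ! v" "gs ! u = gs ! v"
    then show "u = v" using L assms(2) nth_eq_iff_index_eq[of "zip hs gs" u v] by auto
  qed (use ax edge nest in auto)
  then show ?thesis unfolding layer_def using tri by blast
qed

lemma girth_cover_of_list_drawings:
  assumes "list_all (\<lambda>(hs, gs, es). length hs = N \<and> list_drawing hs gs es) Ds" "Ds \<noteq> []"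
    and "list_all (\<lambda>u. list_all (\<lambda>v. list_ex (\<lambda>(hs, gs, es). (u, v) \<in> set es \<or> (v, u) \<in> set es) Ds) [0..<u]) [0..<N]"
    and "1 \<le> n" "n \<le> N"
  shows "\<exists>H. girth_cover 4 (complete_graph n) (length Ds) H"
proof (rule girth_cover_of_layers[where V = "{..<N}" and R = "\<lambda>i u v. (u, v) \<in> set (snd (snd (Ds ! i)))"])
  show "layer {..<N} (\<lambda>u v. (u, v) \<in> set (snd (snd (Ds ! i))))" if "i < length Ds" for i
  proof -
    obtain hs gs es where D: "Ds ! i = (hs, gs, es)" by (cases "Ds ! i")
    then have "length hs = N" "list_drawing hs gs es"
      using assms(1) that by (auto simp: list_all_length)
    then show ?thesis using layer_of_list_drawing[of hs gs es N] D by simp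
  qed
  have cov: "\<exists>i<length Ds. (u, v) \<in> set (snd (snd (Ds ! i))) \<or> (v, u) \<in> set (snd (snd (Ds ! i)))"
    if "v < u" "u < N" for u v
  proof -
    have "list_ex (\<lambda>(hs, gs, es). (u, v) \<in> set es \<or> (v, u) \<in> set es) Ds"
      using assms(3) that by (simp add: list_all_iff)
    then show ?thesis by (simp add: list_ex_length case_prod_beta)
  qed
  show "\<exists>i<length Ds. (u, v) \<in> set (snd (snd (Ds ! i))) \<or> (v, u) \<in> set (snd (snd (Ds ! i)))"
    if "u \<in> {..<N}" "v \<in> {..<N}" "u \<noteq> v" for u v
    using cov[of u v] cov[of v u] that by (cases "v < u") auto
qed (use assms in \<open>auto simp: Suc_le_eq\<close>)

lemma girth_cover_K2: "1 \<le> n \<Longrightarrow> n \<le> 2 \<Longrightarrow> \<exists>H. girth_cover 4 (complete_graph n) 1 H"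
  using girth_cover_of_list_drawings[of 2 "[([1, 2], [0, 0], [(0, 1)])]" n]
  by (simp add: list_drawing_def upt_rec)

text \<open>K_5 is the union of two 5-cycles, a pentagon and its pentagram. Each is a path on the
  horizontal axis with its ends joined to an apex on the vertical axis.\<close>

lemma girth_cover_K5: "1 \<le> n \<Longrightarrow> n \<le> 5 \<Longrightarrow> \<exists>H. girth_cover 4 (complete_graph n) 2 H"
proof -
  let ?D = "[([1,2,3,4,0], [0,0,0,0,1], [(0,1),(1,2),(2,3),(0,4),(3,4)]),
    ([1,4,2,0,3], [0,0,0,1,0], [(0,2),(2,4),(4,1),(0,3),(1,3)])] :: (int list \<times> int list \<times> (nat \<times> nat) list) list"
  have 1: "list_all (\<lambda>(hs, gs, es). length hs = 5 \<and> list_drawing hs gs es) ?D" by code_simp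
  have 2: "list_all (\<lambda>u. list_all (\<lambda>v. list_ex (\<lambda>(hs, gs, es). (u, v) \<in> set es \<or> (v, u) \<in> set es) ?D) [0..<u]) [0..<5]"
    by code_simp
  show "1 \<le> n \<Longrightarrow> n \<le> 5 \<Longrightarrow> ?thesis" using girth_cover_of_list_drawings[OF 1 _ 2, of n] by (simp add: numeral_2_eq_2)
qed

text \<open>Vertices 0--3 and 4--7 are the quadruples of the general construction below with \<open>k = 2\<close>, and 8
  is one of its two extra vertices. The cyclic tournament of the general case does not exist for two
  quadruples; instead the edge \<open>{1, 5}\<close> is moved to the last layer to make room for vertex 8.\<close>

lemma girth_cover_K9: "1 \<le> n \<Longrightarrow> n \<le> 9 \<Longrightarrow> \<exists>H. girth_cover 4 (complete_graph n) 3 H"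
proof -
  \<comment> \<open>Vertex 8 has two neighbours in each of the first two layers and the other four
    in the last.\<close>
  let ?D = "[([0,-2,0,2,-1,0,1,0,-3], [1,0,-1,0,0,3,0,2,0],
      [(1,0),(1,2),(1,7),(3,0),(3,2),(3,5),(3,7),(4,0),(4,2),(6,0),(6,2),(8,5),(8,1)]),
    ([3,0,-3,0,1,0,-1,0,2], [0,1,0,-1,0,2,0,-2,0],
      [(4,1),(4,3),(4,5),(4,7),(6,1),(6,3),(6,5),(6,7),(0,5),(0,7),(2,5),(2,7),(4,8),(8,0)]),
    ([1,4,2,3,8,5,7,6,0], [0,0,0,0,0,0,0,0,1],
      [(0,2),(3,1),(1,5),(5,7),(6,4),(2,8),(3,8),(7,8),(6,8)])] :: (int list \<times> int list \<times> (nat \<times> nat) list) list"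
  have 1: "list_all (\<lambda>(hs, gs, es). length hs = 9 \<and> list_drawing hs gs es) ?D" by code_simp
  have 2: "list_all (\<lambda>u. list_all (\<lambda>v. list_ex (\<lambda>(hs, gs, es). (u, v) \<in> set es \<or> (v, u) \<in> set es) ?D) [0..<u]) [0..<9]"
    by code_simp
  show "1 \<le> n \<Longrightarrow> n \<le> 9 \<Longrightarrow> ?thesis" using girth_cover_of_list_drawings[OF 1 _ 2, of n] by (simp add: numeral_3_eq_3)
qed

section \<open>The general construction\<close>

text \<open>The vertices \<open>(j, r)\<close> with \<open>j < k\<close>, \<open>r < 4\<close> form \<open>k\<close> quadruples; \<open>(k, 0)\<close> and \<open>(k, 2)\<close>
  are two extra vertices.\<close>

definition quad_verts :: "nat \<Rightarrow> (nat \<times> nat) set" where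
  "quad_verts k = {..<k} \<times> {..<4} \<union> {(k, 0), (k, 2)}"

lemma card_quad_verts: "card (quad_verts k) = 4 * k + 2"
proof -
  have "({..<k} \<times> {..<4}) \<inter> {(k, 0), (k, 2)} = ({} :: (nat \<times> nat) set)" by auto
  then show ?thesis unfolding quad_verts_def by (subst card_Un_disjoint) (auto simp: card_cartesian_product)
qed

text \<open>In the \<open>i\<close>-th layer the vertices \<open>(j, r)\<close> with \<open>even r = T j\<close> lie on the horizontal axis. Of
  quadruple \<open>i\<close>, the odd vertices are the outermost ones there, and the even vertices are the
  innermost ones on the vertical axis. Each extra vertex sits between an odd vertex of
  quadruple \<open>i\<close> and a vertex of quadruple \<open>s\<close>.\<close>

definition quad_layer :: "nat \<Rightarrow> (nat \<Rightarrow> bool) \<Rightarrow> nat \<Rightarrow> nat \<Rightarrow> nat \<times> nat \<Rightarrow> nat \<times> nat \<Rightarrow> bool" where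
  "quad_layer k T i s u v \<longleftrightarrow>
     fst u < k \<and> fst v < k \<and> (fst u = i \<or> fst v = i) \<and> even (snd u) = T (fst u) \<and> even (snd v) \<noteq> T (fst v) \<or>
     (u, v) \<in> {((i, 1), (k, 0)), ((k, 0), (s, 0)), ((s, 2), (k, 2)), ((k, 2), (i, 3))}"

text \<open>Apart from the extra vertices, the layer is two complete bipartite graphs with a side of
  size two, sharing the 4-cycle of quadruple \<open>i\<close>. One of these sides is outermost on
  the horizontal axis, the other innermost on the vertical axis, so the edges nest.\<close>

lemma layer_quad_layer:
  assumes "i < k" "s < k" "s \<noteq> i" "\<not> T i" "T s" "T k"
  shows "layer (quad_verts k) (quad_layer k T i s)"
proof -
  \<comment> \<open>From outside in: quadruple \<open>i\<close>, the extra vertices, quadruple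
    \<open>s\<close>, all others. The first three levels are consecutive, so unit segments join the
    extra vertices to both neighbours.\<close>
  define M :: "nat \<Rightarrow> int" where
    "M = (\<lambda>j. if j = i then int k + 3 else if j = k then int k + 2 else if j = s then int k + 1 else int j + 1)"
  define N :: "nat \<Rightarrow> int" where "N = (\<lambda>j. if j = i then 1 else int j + 2)"
  define sg :: "nat \<Rightarrow> int" where "sg = (\<lambda>r. if r < 2 then -1 else 1)"
  define h where "h = (\<lambda>(j, r). if even r = T j then sg r * M j else 0)"
  define g where "g = (\<lambda>(j, r). if even r = T j then 0 else sg r * N j)"
  have M: "M j > 0" "N j > 0" for j by (auto simp: M_def N_def)
  have M_inj: "j = j'" if "M j = M j'" "j \<le> k" "j' \<le> k" for j j'
    using that assms(1-3) by (auto simp: M_def split: if_splits)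
  have N_inj: "j = j'" if "N j = N j'" for j j' using that by (auto simp: N_def split: if_splits)
  have M_max: "M j < M i" if "j \<noteq> i" "j \<le> k" for j using that assms(1) by (auto simp: M_def)
  have N_min: "N i \<le> N j" for j by (auto simp: N_def)
  have sg: "sg r = 1 \<or> sg r = -1" for r by (auto simp: sg_def)
  have abs: "\<bar>h (j, r)\<bar> = (if even r = T j then M j else 0)" "\<bar>g (j, r)\<bar> = (if even r = T j then 0 else N j)" for j r
    using sg[of r] M[of j] by (auto simp: h_def g_def abs_mult)
  have zero: "h (j, r) = 0 \<longleftrightarrow> even r \<noteq> T j" "g (j, r) = 0 \<longleftrightarrow> even r = T j" for j r
    using sg[of r] M[of j] by (auto simp: h_def g_def)
  have r_eq: "r = r'" if "sg r = sg r'" "even r = even r'" "r < 4" "r' < 4" for r r'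
  proof -
    have "r \<in> {0, 1, 2, 3}" "r' \<in> {0, 1, 2, 3}" using that(3,4) by auto
    then show ?thesis using that(1,2) by (auto simp: sg_def)
  qed
  have sg_eq: "sg r = sg r' \<and> m = m'" if "sg r * m = sg r' * m'" "m > 0" "m' > 0" for r r' m m'
    using that sg[of r] sg[of r'] by auto
  have V: "j \<le> k" "r < 4" if "(j, r) \<in> quad_verts k" for j r using that by (auto simp: quad_verts_def)
  have "axis_drawing (quad_verts k) (quad_layer k T i s) h g"
  proof
    fix u v assume uv: "u \<in> quad_verts k" "v \<in> quad_verts k" "h u = h v" "g u = g v"
    obtain j r j' r' where [simp]: "u = (j, r)" "v = (j', r')" by fastforce
    note V' = V[of j r] V[of j' r']
    show "u = v"
    proof (cases "even r = T j")
      case True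
      then have *: "even r' = T j'" using uv(4) zero(2)[of j r] zero(2)[of j' r'] by simp
      then have "sg r = sg r' \<and> M j = M j'" using uv True M sg_eq by (auto simp: h_def)
      then show ?thesis using M_inj[of j j'] r_eq[of r r'] V' uv * True by auto
    next
      case False
      then have *: "even r' \<noteq> T j'" using uv(4) zero(2)[of j r] zero(2)[of j' r'] by simp
      then have "sg r = sg r' \<and> N j = N j'" using uv False M sg_eq by (auto simp: g_def)
      then show ?thesis using N_inj[of j j'] r_eq[of r r'] V' uv * False by auto
    qed
  next
    fix v show "(h v = 0) \<noteq> (g v = 0)" using zero by (cases v) auto
  next
    fix u v assume "quad_layer k T i s u v"
    then consider "even (snd u) = T (fst u)" "even (snd v) \<noteq> T (fst v)"
      | "u = (i, 1)" "v = (k, 0)" | "u = (k, 0)" "v = (s, 0)" | "u = (s, 2)" "v = (k, 2)" | "u = (k, 2)" "v = (i, 3)"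
      by (auto simp: quad_layer_def)
    then show "g u = 0 \<and> h v = 0 \<or> g u = 0 \<and> g v = 0 \<and> h v = h u + 1 \<or>
        h u = 0 \<and> h v = 0 \<and> g u = - 1 \<and> g v = 1"
    proof cases
      case 1
      then show ?thesis using zero[of "fst u" "snd u"] zero[of "fst v" "snd v"] by simp
    qed (use assms in \<open>auto simp: h_def g_def sg_def M_def\<close>)
  next
    fix u v u' v' assume uv: "u \<in> quad_verts k" "v \<in> quad_verts k" "u' \<in> quad_verts k" "v' \<in> quad_verts k"
      "quad_layer k T i s u v" "quad_layer k T i s u' v'" "h u * h u' > 0" "g v * g v' > 0" "\<bar>h u\<bar> < \<bar>h u'\<bar>"
    obtain j r where u: "u = (j, r)" by fastforce
    obtain j' r' where u': "u' = (j', r')" by fastforce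
    have "even r = T j" "even r' = T j'" using uv(7) zero u u' by (metis mult_eq_0_iff less_irrefl)+
    then have "M j < M j'" using uv(9) abs(1)[of j r] abs(1)[of j' r'] u u' by simp
    \<comment> \<open>The end nearer to the origin is not in quadruple \<open>i\<close>, so
      \<open>v\<close> is, and there it has the least height \<open>N i\<close>.\<close>
    then have "j \<noteq> i" using M_max[of j'] V[of j' r'] uv(3) u' by (metis less_asym less_irrefl)
    have gv: "g v \<noteq> 0" "g v' \<noteq> 0" using uv(8) by auto
    have "g (k, 0) = 0" "g (s, 0) = 0" "g (k, 2) = 0" "g (i, 3) = 0" using assms zero by auto
    then have "fst v = i" using uv(5) u \<open>j \<noteq> i\<close> gv(1) by (auto simp: quad_layer_def)
    then have "\<bar>g v\<bar> \<le> N i" using abs(2)[of i "snd v"] M(2)[of i] by (cases v) (auto split: if_splits)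
    also have "\<dots> \<le> N (fst v')" by (rule N_min)
    also have "\<dots> = \<bar>g v'\<bar>" using abs(2)[of "fst v'" "snd v'"] gv(2) zero(2)[of "fst v'" "snd v'"]
      by (cases v') auto
    finally show "\<bar>g v\<bar> \<le> \<bar>g v'\<bar>" .
  qed
  then show ?thesis
    by (rule layer_of_2_colouring[where col = "\<lambda>(j, r). j < k \<and> even r = T j"])
      (use assms in \<open>auto simp: quad_layer_def split: prod.splits\<close>)
qed

text \<open>The last layer consists of the pairs of opposite vertices of the quadruples, each of them
  being the middle edge of a path of length three between the extra vertices.\<close>

definition pair_layer :: "nat \<Rightarrow> nat \<times> nat \<Rightarrow> nat \<times> nat \<Rightarrow> bool" where
  "pair_layer k u v \<longleftrightarrow>
     fst u < k \<and> (snd u \<in> {2, 3} \<and> v = (k, 0) \<or> snd u \<in> {0, 1} \<and> v = (k, 2) \<or>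
       v = (fst u, snd u + 2) \<and> snd u \<in> {0, 1}) \<or>
     u = (k, 2) \<and> v = (k, 0)"

lemma layer_pair_layer: "layer (quad_verts k) (pair_layer k)"
proof -
  \<comment> \<open>The order 0, 2, 1, 3 makes opposite vertices neighbours on the axis. The extra
    vertices are at heights 1 and -1, joined through the origin.\<close>
  define h :: "nat \<times> nat \<Rightarrow> int" where
    "h = (\<lambda>(j, r). if j = k then 0 else 4 * int j + (if r = 0 then 1 else if r = 2 then 2 else if r = 1 then 3 else 4))"
  define g :: "nat \<times> nat \<Rightarrow> int" where "g = (\<lambda>(j, r). if j \<noteq> k then 0 else if r = 0 then 1 else -1)"
  have "axis_drawing (quad_verts k) (pair_layer k) h g"
  proof
    fix u v assume uv: "u \<in> quad_verts k" "v \<in> quad_verts k" "h u = h v" "g u = g v"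
    obtain j r j' r' where u: "u = (j, r)" "v = (j', r')" by fastforce
    show "u = v"
    proof (cases "j = k \<or> j' = k")
      case True
      then show ?thesis using uv u by (auto simp: quad_verts_def g_def split: if_splits)
    next
      case False
      then have "r \<in> {0, 1, 2, 3}" "r' \<in> {0, 1, 2, 3}" using uv u by (auto simp: quad_verts_def)
      then show ?thesis using False uv(3) u by (auto simp: h_def) presburger+
    qed
  next
    fix v :: "nat \<times> nat" show "(h v = 0) \<noteq> (g v = 0)" by (cases v) (auto simp: h_def g_def)
  next
    fix u v assume "pair_layer k u v"
    then show "g u = 0 \<and> h v = 0 \<or> g u = 0 \<and> g v = 0 \<and> h v = h u + 1 \<or>
        h u = 0 \<and> h v = 0 \<and> g u = - 1 \<and> g v = 1"
      by (cases u) (auto simp: pair_layer_def h_def g_def)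
  next
    fix u v u' v' assume "g v * g v' > 0"
    then show "\<bar>g v\<bar> \<le> \<bar>g v'\<bar>" by (cases v; cases v') (auto simp: g_def split: if_splits)
  qed
  then show ?thesis
    by (rule layer_of_2_colouring[where col = "\<lambda>(j, r). if j = k then r = 0 else r < 2"])
      (auto simp: pair_layer_def)
qed

lemma girth_cover_general:
  assumes "3 \<le> k" "1 \<le> n" "n \<le> 4 * k + 2"
  shows "\<exists>H. girth_cover 4 (complete_graph n) (Suc k) H"
proof -
  text \<open>A tournament on the quadruples containing the cycle \<open>0, 1, \<dots>, k - 1\<close>; it exists since \<open>k \<ge> 3\<close>.\<close>
  define T where "T = (\<lambda>i j. j = k \<or> (if i = 0 \<and> Suc j = k \<or> Suc i = k \<and> j = 0 then j < i else i < j))"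
  \<comment> \<open>The successor on the cycle. \<open>T i (s i)\<close> puts the even vertices of
    quadruple \<open>s i\<close> on the horizontal axis of layer \<open>i\<close>, next to the extra
    vertices.\<close>
  define s where "s = (\<lambda>i. if Suc i = k then 0 else Suc i)"
  have T: "\<not> T i i" "T i (s i)" "T i k" "s i < k" "s i \<noteq> i" if "i < k" for i
    using that assms(1) by (auto simp: T_def s_def)
  have T_anti: "T j i \<longleftrightarrow> \<not> T i j" if "i < k" "j < k" "i \<noteq> j" for i j
    using that assms(1) by (auto simp: T_def)
  have s_surj: "\<exists>i<k. s i = j" if "j < k" for j
  proof (cases j)
    case 0
    then show ?thesis using that by (intro exI[of _ "k - 1"]) (auto simp: s_def)
  next
    case (Suc i)
    then show ?thesis using that by (intro exI[of _ i]) (auto simp: s_def)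
  qed
  define R where "R = (\<lambda>l. if l = k then pair_layer k else quad_layer k (T l) l (s l))"
  define ok where "ok = (\<lambda>u v. \<exists>i<Suc k. R i u v \<or> R i v u)"
  have ok_sym: "ok u v \<Longrightarrow> ok v u" for u v by (auto simp: ok_def)
  have ok_quad: "ok u v" if "i < k" "quad_layer k (T i) i (s i) u v \<or> quad_layer k (T i) i (s i) v u" for i u v
    unfolding ok_def using that by (intro exI[of _ i]) (auto simp: R_def)
  have ok_pair: "ok u v" if "pair_layer k u v \<or> pair_layer k v u" for u v
    unfolding ok_def using that by (intro exI[of _ k]) (auto simp: R_def)
  have quads: "ok (i, r) (j, r')" if "i < k" "j < k" "r < 4" "r' < 4" "(i, r) \<noteq> (j, r')" for i j r r'
  proof (cases "i = j")
    case True
    show ?thesis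
    proof (cases "even r = even r'")
      case True
      then have "r = r' + 2 \<or> r' = r + 2"
        using \<open>r < 4\<close> \<open>r' < 4\<close> \<open>(i, r) \<noteq> (j, r')\<close> \<open>i = j\<close> by simp presburger
      then show ?thesis using that \<open>i = j\<close> by (intro ok_pair) (auto simp: pair_layer_def)
    next
      case False
      then show ?thesis using that \<open>i = j\<close> T(1)[of i] by (intro ok_quad[of i]) (auto simp: quad_layer_def)
    qed
  next
    case False
    show ?thesis
    \<comment> \<open>Layer \<open>i\<close> joins vertices of equal parity in quadruples
      \<open>i\<close> and \<open>j\<close> if \<open>T i j\<close>, and of different parity
      otherwise; by antisymmetry layer \<open>j\<close> does the opposite.\<close>
    proof (cases "even (r + r') = T i j")
      case True
      then show ?thesis using that T(1)[of i] by (intro ok_quad[of i]) (auto simp: quad_layer_def)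
    next
      case F: False
      then show ?thesis using that False T(1)[of j] T_anti[of i j]
        by (intro ok_quad[of j]) (auto simp: quad_layer_def)
    qed
  qed
  have extra: "ok (i, r) (k, e)" if "i < k" "r < 4" "e \<in> {0, 2}" for i r e
  proof -
    obtain l where l: "l < k" "s l = i" using s_surj[OF \<open>i < k\<close>] by blast
    \<comment> \<open>The edge is in the layer whose successor is \<open>i\<close>, in layer
      \<open>i\<close>, or, in the last two cases, in the last layer.\<close>
    consider "r = e" | "r = e + 1" | "e = 0" "r \<in> {2, 3}" | "e = 2" "r \<in> {0, 1}"
      using \<open>r < 4\<close> \<open>e \<in> {0, 2}\<close> by (auto simp: numeral_eq_Suc less_Suc_eq)
    then show ?thesis
    proof cases
      case 1
      then show ?thesis using l that(3) by (intro ok_quad[of l]) (auto simp: quad_layer_def)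
    next
      case 2
      then show ?thesis using that by (intro ok_quad[of i]) (auto simp: quad_layer_def)
    qed (use that in \<open>auto intro!: ok_pair simp: pair_layer_def\<close>)
  qed
  have "ok (k, 0) (k, 2)" by (rule ok_pair) (simp add: pair_layer_def)
  then have "ok u v" if "u \<in> quad_verts k" "v \<in> quad_verts k" "u \<noteq> v" for u v
    using that quads extra ok_sym unfolding quad_verts_def by auto
  then show ?thesis
    using assms T layer_quad_layer layer_pair_layer
    by (intro girth_cover_of_layers[of n "quad_verts k" "Suc k" R])
      (auto simp: card_quad_verts R_def ok_def less_Suc_eq)
qed

text \<open>Here \<open>(n + 5) div 4\<close> is the ceiling of (n + 2) / 4. The exceptions 6 and 10
  are 4 m + 2 for m = 1 and m = 2, too few quadruples for a directed cycle; K_6 is taken from the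
  three layers for K_9.\<close>

lemma girth_cover_upper:
  assumes "1 \<le> n" "n \<noteq> 6 \<and> n \<noteq> 10 \<and> k = (n + 5) div 4 \<or> n = 6 \<and> k = 3"
  shows "\<exists>H. girth_cover 4 (complete_graph n) k H"
proof -
  consider "n \<le> 2" "k = 1" | "n \<le> 5" "k = 2" | "n \<le> 9" "k = 3" | "11 \<le> n" "k = (n + 5) div 4"
    using assms by linarith
  then show ?thesis
  proof cases
    case 4
    define m where "m = k - 1"
    have "k = Suc m" "3 \<le> m" "n \<le> 4 * m + 2" using 4 unfolding m_def by presburger+
    then show ?thesis using girth_cover_general assms(1) by blast
  qed (use girth_cover_K2 girth_cover_K5 girth_cover_K9 assms(1) in blast)+
qed

lemma girth_thickness_eqI:
  assumes "\<exists>H. girth_cover g G k H" "\<And>k' H. girth_cover g G k' H \<Longrightarrow> k \<le> k'"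
  shows "girth_thickness g G = k"
  unfolding girth_thickness_def using assms by (intro Least_equality) auto

theorem theorem1:
  shows "(\<forall>n::nat. n \<ge> 1 \<and> n \<noteq> 6 \<and> n \<noteq> 10 \<longrightarrow>
            int (girth_thickness 4 (complete_graph n)) = \<lceil>(real n + 2) / 4\<rceil>)
         \<and> girth_thickness 4 (complete_graph 6) = 3"
proof (intro conjI allI impI)
  fix n :: nat assume n: "n \<ge> 1 \<and> n \<noteq> 6 \<and> n \<noteq> 10"
  have "girth_thickness 4 (complete_graph n) = (n + 5) div 4"
  proof (rule girth_thickness_eqI)
    show "\<exists>H. girth_cover 4 (complete_graph n) ((n + 5) div 4) H"
      using n by (intro girth_cover_upper) auto
    show "(n + 5) div 4 \<le> k" if "girth_cover 4 (complete_graph n) k H" for k H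
      using girth_cover_4_complete_graph_lower[OF that] n by linarith
  qed
  moreover have "4 * ((n + 5) div 4) \<le> n + 5" "n + 2 \<le> 4 * ((n + 5) div 4)" by linarith+
  then have "4 * real ((n + 5) div 4) \<le> real n + 5" "real n + 2 \<le> 4 * real ((n + 5) div 4)"
    by linarith+
  then have "\<lceil>(real n + 2) / 4\<rceil> = int ((n + 5) div 4)"
    by (intro ceiling_unique) auto
  ultimately show "int (girth_thickness 4 (complete_graph n)) = \<lceil>(real n + 2) / 4\<rceil>" by simp
next
  show "girth_thickness 4 (complete_graph 6) = 3"
    using girth_cover_upper[of 6 3] girth_cover_4_K6_lower by (intro girth_thickness_eqI) auto
qed

end
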